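(* Let $k\in(0,1)$ and let $g\in\mathcal{M}$ satisfy $$|U_g(\zeta)|\le k\quad\text{for all }\zeta\in\mathbb{D}^*.$$ Then $g$ is univalent in $\mathbb{D}^*$ and has the following $k$-quasiconformal extension onto $\widehat{\mathbb{C}}$: $$G(\zeta)=\begin{cases} g(\zeta), & |\zeta|>1,\\[1mm] \dfrac{g(1/\overline{\zeta})}{1+(1/\zeta-\overline{\zeta})\,g(1/\overline{\zeta})}, & |\zeta|\le 1.\end{cases}$$
   Context: $\mathbb{D}^*=\{z:|z|>1\}$ (including $\infty$ where meromorphic functions are considered), $\widehat{\mathbb{C}}=\mathbb{C}\cup\{\infty\}$. $\mathcal{M}$ is the class of meromorphic functions $g$ on $\mathbb{D}^*$ that are analytic in $\mathbb{D}^*$ except for a simple pole at $\zeta=\infty$ with $g'(\infty)=1$, i.e. with expansion $g(\zeta)=\zeta+\sum_{n=0}^\infty b_n\zeta^{-n}$ for $|\zeta|>1$. For $g\in\mathcal{M}$, $U_g(\zeta)=(\zeta/g(\zeta))^2g'(\zeta)-1$; a bound on $|U_g|$ in $\mathbb{D}^*$ means in particular that $U_g$ has no poles there, so $g$ has no zeros in $\mathbb{D}^*$. For $k\in[0,1)$, a $k$-quasiconformal mapping of $\widehat{\mathbb{C}}$ is a sense-preserving homeomorphism $G:\widehat{\mathbb{C}}\to\widehat{\mathbb{C}}$ belonging to the Sobolev space $W^{1,2}_{\mathrm{loc}}(\widehat{\mathbb{C}})$ with $|G_{\bar z}|\le k|G_z|$ a.e. A $k$-quasiconformal extension of $g$ onto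 $\widehat{\mathbb{C}}$ is such a $G$ with $G|_{\mathbb{D}^*}=g$. Formulas for $G$ are read as maps into $\widehat{\mathbb{C}}$; the value at $\zeta=0$ and the values on $|\zeta|=1$ are understood by continuous extension. *)

theory Defs
  imports "HOL-Complex_Analysis.Complex_Analysis"
begin

text \<open>The Riemann sphere is the one-point compactification of the complex plane:
  \<open>Some z\<close> is the finite point \<open>z\<close> and \<open>None\<close> is the point at infinity.\<close>

type_synonym riemann_sphere = "complex option"

definition sphere_topology :: "riemann_sphere topology" where
  "sphere_topology = Alexandroff_compactification euclidean"

text \<open>In \<open>sphere_quotient\<close> the case \<open>0/0\<close> has no meaning; its value there is irrelevant.\<close>

definition sphere_quotient :: "complex \<Rightarrow> complex \<Rightarrow> riemann_sphere" where
  "sphere_quotient a b = (if b = 0 then None else Some (a / b))"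

definition sphere_inversion :: "riemann_sphere \<Rightarrow> riemann_sphere" where
  "sphere_inversion p = (case p of None \<Rightarrow> Some 0 | Some z \<Rightarrow> sphere_quotient 1 z)"

text \<open>The charts of the sphere are \<open>z\<close> and \<open>1/z\<close>, in the source and in the target.
  The four maps below are \<open>G\<close> read in these charts; each of them is to be viewed
  as a complex-valued function \<open>finite_part F\<close> on the set \<open>finite_domain F\<close>
  (open if \<open>G\<close> is continuous).\<close>

definition chart_representations ::
    "(riemann_sphere \<Rightarrow> riemann_sphere) \<Rightarrow> (riemann_sphere \<Rightarrow> riemann_sphere) set" where
  "chart_representations G =
     {t \<circ> G \<circ> s | s t. s \<in> {id, sphere_inversion} \<and> t \<in> {id, sphere_inversion}}"

definition finite_domain :: "(riemann_sphere \<Rightarrow> riemann_sphere) \<Rightarrow> complex set" where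
  "finite_domain F = {z. F (Some z) \<noteq> None}"

definition finite_part :: "(riemann_sphere \<Rightarrow> riemann_sphere) \<Rightarrow> complex \<Rightarrow> complex" where
  "finite_part F z = the (F (Some z))"

text \<open>A homeomorphism preserves sense if, in charts, small positively oriented circles
  around a point are mapped to curves of index \<open>+1\<close> around the image point.\<close>

definition sense_preserving :: "(riemann_sphere \<Rightarrow> riemann_sphere) \<Rightarrow> bool" where
  "sense_preserving G \<longleftrightarrow>
     (\<forall>F \<in> chart_representations G. \<forall>z \<in> finite_domain F.
        \<forall>\<^sub>F r in at_right 0.
          winding_number (finite_part F \<circ> circlepath z r) (finite_part F z) = 1)"

primrec Ck :: "nat \<Rightarrow> (complex \<Rightarrow> real) \<Rightarrow> bool" where
  "Ck 0 \<phi> \<longleftrightarrow> continuous_on UNIV \<phi>"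
| "Ck (Suc n) \<phi> \<longleftrightarrow>
     (\<forall>z. \<phi> differentiable (at z)) \<and> (\<forall>v. Ck n (\<lambda>z. frechet_derivative \<phi> (at z) v))"

definition test_functions :: "complex set \<Rightarrow> (complex \<Rightarrow> real) set" where
  "test_functions \<Omega> =
     {\<phi>. (\<forall>n. Ck n \<phi>) \<and> compact (closure (support_on UNIV \<phi>)) \<and>
         closure (support_on UNIV \<phi>) \<subseteq> \<Omega>}"

definition weak_directional_derivative ::
    "complex set \<Rightarrow> complex \<Rightarrow> (complex \<Rightarrow> complex) \<Rightarrow> (complex \<Rightarrow> complex) \<Rightarrow> bool" where
  "weak_directional_derivative \<Omega> v f f' \<longleftrightarrow>
     (\<forall>\<phi> \<in> test_functions \<Omega>.
        (LINT z:\<Omega>|lebesgue. frechet_derivative \<phi> (at z) v *\<^sub>R f z)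
          = - (LINT z:\<Omega>|lebesgue. \<phi> z *\<^sub>R f' z))"

definition L2_loc :: "complex set \<Rightarrow> (complex \<Rightarrow> complex) \<Rightarrow> bool" where
  "L2_loc \<Omega> f \<longleftrightarrow>
     (\<forall>K. compact K \<and> K \<subseteq> \<Omega> \<longrightarrow>
        set_borel_measurable lebesgue K f \<and>
        set_integrable lebesgue K (\<lambda>z. (cmod (f z))\<^sup>2))"

text \<open>\<open>W12_loc \<Omega> f f\<^sub>x f\<^sub>y\<close>: the function \<open>f\<close> is in the local Sobolev space of
  exponents \<open>(1,2)\<close> on \<open>\<Omega>\<close>, with weak partial derivatives \<open>f\<^sub>x\<close> and \<open>f\<^sub>y\<close>.\<close>

definition W12_loc :: "complex set \<Rightarrow> (complex \<Rightarrow> complex) \<Rightarrow>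
    (complex \<Rightarrow> complex) \<Rightarrow> (complex \<Rightarrow> complex) \<Rightarrow> bool" where
  "W12_loc \<Omega> f f\<^sub>x f\<^sub>y \<longleftrightarrow>
     L2_loc \<Omega> f \<and> L2_loc \<Omega> f\<^sub>x \<and> L2_loc \<Omega> f\<^sub>y \<and>
     weak_directional_derivative \<Omega> 1 f f\<^sub>x \<and> weak_directional_derivative \<Omega> \<i> f f\<^sub>y"

text \<open>With \<open>f\<^sub>z = (f\<^sub>x - i f\<^sub>y)/2\<close> and \<open>f\<^sub>z\<^sub>b\<^sub>a\<^sub>r = (f\<^sub>x + i f\<^sub>y)/2\<close>. Weak derivatives are unique
  up to null sets, so the choice of \<open>f\<^sub>x\<close> and \<open>f\<^sub>y\<close> does not matter.\<close>

definition quasiconformal :: "real \<Rightarrow> (riemann_sphere \<Rightarrow> riemann_sphere) \<Rightarrow> bool" where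
  "quasiconformal k G \<longleftrightarrow>
     0 \<le> k \<and> k < 1 \<and>
     homeomorphic_map sphere_topology sphere_topology G \<and>
     sense_preserving G \<and>
     (\<forall>F \<in> chart_representations G. \<exists>f\<^sub>x f\<^sub>y.
        W12_loc (finite_domain F) (finite_part F) f\<^sub>x f\<^sub>y \<and>
        (AE z in lebesgue. z \<in> finite_domain F \<longrightarrow>
           cmod ((f\<^sub>x z + \<i> * f\<^sub>y z) / 2) \<le> k * cmod ((f\<^sub>x z - \<i> * f\<^sub>y z) / 2)))"

definition exterior_disk :: "complex set" where
  "exterior_disk = {\<zeta>. 1 < cmod \<zeta>}"

text \<open>Functions of the class below are given by their values at finite points;
  their value at infinity is infinity.\<close>

definition class_M :: "(complex \<Rightarrow> complex) set" where
  "class_M = {g. g holomorphic_on exterior_disk \<and>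
     (\<exists>b. \<forall>\<zeta> \<in> exterior_disk. (\<lambda>n. b n / \<zeta> ^ n) sums (g \<zeta> - \<zeta>))}"

text \<open>At a zero of \<open>g\<close> in \<open>exterior_disk\<close> the function below has a pole, but the
  convention \<open>x / 0 = 0\<close> gives it the value \<open>-1\<close> there. Hence a pointwise bound by some
  \<open>k < 1\<close> still excludes zeros of \<open>g\<close>.\<close>

definition U :: "(complex \<Rightarrow> complex) \<Rightarrow> complex \<Rightarrow> complex" where
  "U g \<zeta> = (\<zeta> / g \<zeta>)\<^sup>2 * deriv g \<zeta> - 1"

definition quasiconformal_extension ::
    "real \<Rightarrow> (complex \<Rightarrow> complex) \<Rightarrow> (riemann_sphere \<Rightarrow> riemann_sphere) \<Rightarrow> bool" where
  "quasiconformal_extension k g G \<longleftrightarrow>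
     quasiconformal k G \<and> G None = None \<and> (\<forall>\<zeta> \<in> exterior_disk. G (Some \<zeta>) = Some (g \<zeta>))"

text \<open>The formula is imposed only where it is literally meaningful. The values of \<open>G\<close> at \<open>0\<close>
  and on the unit circle are those of the continuous extension: they are determined as soon
  as \<open>G\<close> is continuous, because the remaining points are dense in the sphere.\<close>

definition given_inside_by_formula ::
    "(complex \<Rightarrow> complex) \<Rightarrow> (riemann_sphere \<Rightarrow> riemann_sphere) \<Rightarrow> bool" where
  "given_inside_by_formula g G \<longleftrightarrow>
     (\<forall>\<zeta>. 0 < cmod \<zeta> \<and> cmod \<zeta> < 1 \<longrightarrow>
        G (Some \<zeta>) = sphere_quotient (g (1 / cnj \<zeta>))
                       (1 + (1 / \<zeta> - cnj \<zeta>) * g (1 / cnj \<zeta>)))"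

end

theory Submission
  imports Defs
begin

text \<open>The function \<open>f(z) = 1/g(1/z)\<close> is analytic in the unit disk, with \<open>f(0) = 0\<close>, and
  \<open>U g (1/z) = f'(z) - 1\<close>. Hence \<open>h(z) = f(z) - z\<close> is \<open>k\<close>-Lipschitz in the disk and extends to the
  closed disk. The folding \<open>\<rho>\<close> of the plane onto the closed disk (\<open>\<rho>(z) = z\<close> inside, \<open>\<rho>(z) = 1/cnj z\<close>
  outside) is 1-Lipschitz, so \<open>F(z) = z + h(\<rho>(z))\<close> differs from the identity by a \<open>k\<close>-Lipschitz map
  of the whole plane. Therefore \<open>F\<close> is a bi-Lipschitz homeomorphism (surjective by Banach's fixed
  point theorem); off the unit circle it is differentiable with \<open>F\<^sub>z = f'\<close>, \<open>F\<^sub>z\<^sub>b\<^sub>a\<^sub>r = 0\<close> inside and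
  \<open>F\<^sub>z = 1\<close>, \<open>|F\<^sub>z\<^sub>b\<^sub>a\<^sub>r| \<le> k\<close> outside. The stated \<open>G\<close> is \<open>1/F(1/\<zeta>)\<close>.\<close>

section \<open>Weak derivatives of locally Lipschitz functions\<close>

text \<open>Three features decide the shape of the argument. \<open>F\<close> need not be
  differentiable on the unit circle, so the sense of the map cannot be read from a Jacobian there;
  the inequality \<open>cmod (F z - F w - (z - w)) \<le> k * cmod (z - w)\<close> holds at all
  points alike, and it keeps the image of a small circle so close to a translate of that circle that
  its index is forced. The Lipschitz bound likewise holds across the circle, so the classical
  derivatives off this null set are the weak derivatives on the whole domain. Finally,
  quasiconformality is demanded of all four chart expressions; as \<open>G\<close> is
  \<open>F\<close> conjugated by the inversion, these are \<open>F\<close>, \<open>1 / F\<close>,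
  \<open>F (1 / z)\<close> and \<open>1 / F (1 / z)\<close>, and the last one needs separate work at
  the origin, where the boundedness of \<open>F z - z\<close> enters. The univalence of
  \<open>g\<close> is read off from the injectivity of \<open>G\<close>.\<close>

text \<open>The difference quotients of a compactly supported Lipschitz function have integral \<open>0\<close> by
  translation invariance, and are dominated. Applied to the product of a test function and a
  locally Lipschitz function this is the integration by parts.\<close>

lemma has_derivative_difference_quotients:
  fixes f :: "'a::real_normed_vector \<Rightarrow> 'b::real_normed_vector"
  assumes "(f has_derivative D) (at z)"
  shows "(\<lambda>n. real (Suc n) *\<^sub>R (f (z + v /\<^sub>R real (Suc n)) - f z)) \<longlonglongrightarrow> D v"
proof (cases "v = 0")
  case True
  with assms show ?thesis
    using has_derivative_linear linear_0 by fastforce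
next
  case False
  let ?h = "\<lambda>n. v /\<^sub>R real (Suc n)"
  have lin: "D (?h n) = D v /\<^sub>R real (Suc n)" for n
    using assms has_derivative_linear linear_scale by blast
  have "?h \<longlonglongrightarrow> 0 *\<^sub>R v"
    by (intro tendsto_scaleR tendsto_const LIMSEQ_inverse_real_of_nat)
  \<comment> \<open>The filter at \<open>0\<close> is punctured, so the increments must never be
    \<open>0\<close>; this is why \<open>v = 0\<close> is a separate case.\<close>
  then have "filterlim ?h (at 0) sequentially"
    using False by (auto simp: filterlim_at)
  moreover have "(\<lambda>h. norm (f (z + h) - f z - D h) / norm h) \<midarrow>0\<rightarrow> 0"
    using assms by (simp add: has_derivative_at)
  ultimately have "(\<lambda>n. norm (f (z + ?h n) - f z - D (?h n)) / norm (?h n)) \<longlonglongrightarrow> 0"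
    by (rule filterlim_compose[rotated])
  then have "(\<lambda>n. norm (f (z + ?h n) - f z - D (?h n)) / norm (?h n) * norm v) \<longlonglongrightarrow> 0 * norm v"
    by (intro tendsto_mult tendsto_const)
  moreover have "norm (f (z + ?h n) - f z - D (?h n)) / norm (?h n) * norm v
      = norm (real (Suc n) *\<^sub>R (f (z + ?h n) - f z) - D v)" for n
  proof -
    have "real (Suc n) *\<^sub>R (f (z + ?h n) - f z) - D v
        = real (Suc n) *\<^sub>R (f (z + ?h n) - f z - D (?h n))"
      unfolding lin by (simp add: scaleR_diff_right del: of_nat_Suc)
    then have "norm (real (Suc n) *\<^sub>R (f (z + ?h n) - f z) - D v)
        = real (Suc n) * norm (f (z + ?h n) - f z - D (?h n))"
      by (simp del: of_nat_Suc)
    then show ?thesis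
      using False by (simp add: field_simps del: of_nat_Suc)
  qed
  ultimately have "(\<lambda>n. norm (real (Suc n) *\<^sub>R (f (z + ?h n) - f z) - D v)) \<longlonglongrightarrow> 0"
    by simp
  then show ?thesis
    by (subst LIM_zero_iff[symmetric]) (rule tendsto_norm_zero_cancel)
qed

lemma integrable_bounded_compact_support:
  fixes f :: "'a::euclidean_space \<Rightarrow> 'b::{banach, second_countable_topology}"
  assumes "f \<in> borel_measurable borel" "compact K"
    and "\<And>z. z \<in> K \<Longrightarrow> norm (f z) \<le> B" "\<And>z. z \<notin> K \<Longrightarrow> f z = 0"
  shows "integrable lborel f"
proof (rule integrableI_bounded_set[where A = K and B = B])
  show "K \<in> sets lborel" using assms by (simp add: borel_compact)
  show "emeasure lborel K < \<infinity>" using assms emeasure_compact_finite by auto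
qed (use assms in auto)

lemma integral_lborel_translation:
  fixes f :: "'a::euclidean_space \<Rightarrow> 'b::{banach, second_countable_topology}"
  assumes "f \<in> borel_measurable borel"
  shows "(\<integral>z. f (z + c) \<partial>lborel) = (\<integral>z. f z \<partial>lborel)"
proof -
  have "(\<integral>z. f z \<partial>lborel) = (\<integral>z. f z \<partial>distr lborel borel ((+) c))"
    by (simp add: lborel_distr_plus)
  also have "\<dots> = (\<integral>z. f (c + z) \<partial>lborel)"
    using assms by (subst integral_distr) auto
  finally show ?thesis by (simp add: add.commute)
qed

lemma integral_directional_derivative_eq_0:
  fixes \<psi> :: "'a::euclidean_space \<Rightarrow> 'b::{banach, second_countable_topology}"
  assumes lip: "L-lipschitz_on UNIV \<psi>" and K: "compact K" and zero: "\<And>z. z \<notin> K \<Longrightarrow> \<psi> z = 0"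
    and D: "D \<in> borel_measurable borel"
    and lim: "AE z in lborel. (\<lambda>n. real (Suc n) *\<^sub>R (\<psi> (z + v /\<^sub>R real (Suc n)) - \<psi> z)) \<longlonglongrightarrow> D z"
  shows "(\<integral>z. D z \<partial>lborel) = 0"
proof -
  obtain R where R: "K \<subseteq> cball 0 R"
    using compact_imp_bounded[OF K] by (force simp: bounded_iff)
  define s where "s n z = real (Suc n) *\<^sub>R (\<psi> (z + v /\<^sub>R real (Suc n)) - \<psi> z)" for n z
  \<comment> \<open>Every increment \<open>v / (n + 1)\<close> has norm at most
    \<open>norm v\<close>, so all quotients vanish outside this one ball, and
    \<open>L * norm v\<close> times its indicator is an integrable majorant independent of
    \<open>n\<close>.\<close>
  define B where "B = cball (0::'a) (R + norm v)"
  have \<psi>: "continuous_on UNIV \<psi>"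
    using lip lipschitz_on_continuous_on by blast
  then have \<psi>m: "\<psi> \<in> borel_measurable borel"
    by (rule borel_measurable_continuous_onI)
  have sm: "s n \<in> borel_measurable borel" for n
    unfolding s_def by (intro borel_measurable_continuous_onI continuous_intros
        continuous_on_compose2[OF \<psi>]) auto
  have s0: "s n z = 0" if "z \<notin> B" for n z
  proof -
    have h: "norm (v /\<^sub>R real (Suc n)) \<le> norm v"
      by (simp add: field_simps mult_le_cancel_left1)
    have "norm z > R + norm v" using that by (auto simp: B_def)
    moreover have "norm z \<le> norm (z + v /\<^sub>R real (Suc n)) + norm (v /\<^sub>R real (Suc n))"
      using norm_triangle_ineq4[of "z + v /\<^sub>R real (Suc n)" "v /\<^sub>R real (Suc n)"] by simp
    ultimately have "norm z > R" "norm (z + v /\<^sub>R real (Suc n)) > R"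
      using h by (smt (verit) norm_ge_zero)+
    then have "z \<notin> K" "z + v /\<^sub>R real (Suc n) \<notin> K"
      using R by (auto simp: subset_iff)
    then show ?thesis by (simp add: s_def zero)
  qed
  have sB: "norm (s n z) \<le> L * norm v" for n z
  proof -
    have "norm (\<psi> (z + v /\<^sub>R real (Suc n)) - \<psi> z) \<le> L * norm (v /\<^sub>R real (Suc n))"
      using lipschitz_onD[OF lip, of "z + v /\<^sub>R real (Suc n)" z] by (simp add: dist_norm)
    then have "real (Suc n) * norm (\<psi> (z + v /\<^sub>R real (Suc n)) - \<psi> z)
       \<le> real (Suc n) * (L * norm (v /\<^sub>R real (Suc n)))"
      by (intro mult_left_mono) auto
    also have "\<dots> = L * norm v" by (simp add: field_simps del: of_nat_Suc)
    finally show ?thesis by (simp add: s_def del: of_nat_Suc)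
  qed
  have w: "integrable lborel (\<lambda>z. indicator B z *\<^sub>R (L * norm v))"
    by (rule integrable_bounded_compact_support[where K = B and B = "\<bar>L * norm v\<bar>"])
      (auto simp: B_def indicator_def)
  have "(\<lambda>n. \<integral>z. s n z \<partial>lborel) \<longlonglongrightarrow> (\<integral>z. D z \<partial>lborel)"
  proof (rule integral_dominated_convergence[OF _ _ w])
    show "AE z in lborel. norm (s n z) \<le> indicator B z *\<^sub>R (L * norm v)" for n
      using s0 sB by (auto simp: indicator_def intro!: AE_I2)
  qed (use D sm lim[folded s_def] in auto)
  moreover have "(\<integral>z. s n z \<partial>lborel) = 0" for n
  proof -
    define h where "h = v /\<^sub>R real (Suc n)"
    have "bounded (\<psi> ` K)"
      using K \<psi> by (meson compact_continuous_image compact_imp_bounded continuous_on_subset subset_UNIV)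
    then obtain M where M: "\<And>z. z \<in> K \<Longrightarrow> norm (\<psi> z) \<le> M"
      unfolding bounded_iff by auto
    have i1: "integrable lborel \<psi>"
      by (rule integrable_bounded_compact_support[OF \<psi>m K M zero])
    have i2: "integrable lborel (\<lambda>z. \<psi> (z + h))"
    proof (rule integrable_bounded_compact_support[where K = "(\<lambda>z. z - h) ` K"])
      show "(\<lambda>z. \<psi> (z + h)) \<in> borel_measurable borel" 
        using \<psi>m by measurable
      show "compact ((\<lambda>z. z - h) ` K)"
        by (intro compact_continuous_image continuous_intros K)
      show "norm (\<psi> (z + h)) \<le> M" if "z \<in> (\<lambda>z. z - h) ` K" for z
        using that M by auto
      show "\<psi> (z + h) = 0" if "z \<notin> (\<lambda>z. z - h) ` K" for z
        using that by (intro zero) (auto simp: image_iff)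
    qed
    have "(\<integral>z. s n z \<partial>lborel)
        = real (Suc n) *\<^sub>R ((\<integral>z. \<psi> (z + h) \<partial>lborel) - (\<integral>z. \<psi> z \<partial>lborel))"
      unfolding s_def h_def[symmetric] using i1 i2 by simp
    then show ?thesis
      by (simp add: integral_lborel_translation[OF \<psi>m])
  qed
  ultimately have "(\<lambda>n. 0) \<longlonglongrightarrow> (\<integral>z. D z \<partial>lborel)" by simp
  then show ?thesis by (simp add: LIMSEQ_const_iff)
qed

section \<open>Locally Lipschitz functions and test functions\<close>

text \<open>The Sobolev conditions and the supports of test functions are quantified over compact
  sets, and a chart expression such as \<open>1 / F\<close> has no Lipschitz constant on its whole
  domain.\<close>

definition lipschitz_on_compacts :: "complex set \<Rightarrow> (complex \<Rightarrow> complex) \<Rightarrow> bool" where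
  "lipschitz_on_compacts \<Omega> f \<longleftrightarrow> (\<forall>K. compact K \<and> K \<subseteq> \<Omega> \<longrightarrow> (\<exists>L. L-lipschitz_on K f))"

lemma lipschitz_on_compactsE:
  assumes "lipschitz_on_compacts \<Omega> f" "compact K" "K \<subseteq> \<Omega>"
  obtains L where "L-lipschitz_on K f"
  using assms unfolding lipschitz_on_compacts_def by metis

lemma lipschitz_on_compacts_continuous_on:
  assumes "open \<Omega>" "lipschitz_on_compacts \<Omega> f"
  shows "continuous_on \<Omega> f"
  unfolding continuous_on_eq_continuous_at[OF assms(1)]
proof
  fix z assume "z \<in> \<Omega>"
  then obtain e where e: "e > 0" "cball z e \<subseteq> \<Omega>"
    using assms(1) open_contains_cball by blast
  then obtain L where "L-lipschitz_on (cball z e) f"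
    using lipschitz_on_compactsE[OF assms(2) compact_cball] by metis
  then have "continuous_on (ball z e) f"
    using continuous_on_subset[OF lipschitz_on_continuous_on ball_subset_cball] by blast
  then show "isCont f z"
    using e by (simp add: continuous_on_eq_continuous_at)
qed

text \<open>The two partial derivatives are continuous and vanish off the compact support, so they
  are bounded; together they bound the operator norm of the derivative, and the mean value
  inequality on the plane turns this into a global Lipschitz constant.\<close>

lemma test_functionE:
  assumes "\<phi> \<in> test_functions \<Omega>"
  obtains K L M where "compact K" "K \<subseteq> \<Omega>" "\<And>z. z \<notin> K \<Longrightarrow> \<phi> z = 0"
    "\<And>z. (\<phi> has_derivative frechet_derivative \<phi> (at z)) (at z)"
    "\<And>z v. z \<notin> K \<Longrightarrow> frechet_derivative \<phi> (at z) v = 0"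
    "\<And>v. continuous_on UNIV (\<lambda>z. frechet_derivative \<phi> (at z) v)"
    "L-lipschitz_on UNIV \<phi>" "\<And>z. \<bar>\<phi> z\<bar> \<le> M"
proof -
  define K where "K = closure (support_on UNIV \<phi>)"
  have K: "compact K" "K \<subseteq> \<Omega>" and Ck: "\<And>n. Ck n \<phi>"
    using assms by (auto simp: test_functions_def K_def)
  have zero: "\<phi> z = 0" if "z \<notin> K" for z
    using that closure_subset[of "support_on UNIV \<phi>"] by (auto simp: K_def support_on_def)
  define D where "D z = frechet_derivative \<phi> (at z)" for z
  have D: "(\<phi> has_derivative D z) (at z)" for z
    using Ck[of 1] by (simp add: D_def frechet_derivative_works)
  have D0: "D z v = 0" if "z \<notin> K" for z v
  proof -
    have "((\<lambda>z. 0) has_derivative D z) (at z)"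
      by (rule has_derivative_transform_within_open[OF D, where s = "- K"])
        (use that zero K compact_imp_closed in auto)
    then have "D z = (\<lambda>v. 0)"
      by (rule has_derivative_unique) simp
    then show ?thesis by simp
  qed
  have DC: "continuous_on UNIV (\<lambda>z. D z v)" for v
  proof -
    have "Ck 2 \<phi>" by (rule Ck)
    then have "(\<lambda>z. D z v) differentiable (at z)" for z
      by (simp add: numeral_2_eq_2 D_def)
    then show ?thesis
      by (simp add: continuous_at_imp_continuous_on differentiable_imp_continuous_within)
  qed
  have bd: "\<exists>M\<ge>0. \<forall>z. \<bar>f z\<bar> \<le> M"
    if "continuous_on UNIV f" "\<And>z. z \<notin> K \<Longrightarrow> f z = 0" for f :: "complex \<Rightarrow> real"
  proof -
    have "bounded (f ` K)"
      using K that by (meson compact_continuous_image compact_imp_bounded continuous_on_subset subset_UNIV)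
    then obtain M where "M > 0" "\<And>z. z \<in> K \<Longrightarrow> \<bar>f z\<bar> \<le> M"
      unfolding bounded_pos by auto
    then show ?thesis
      using that(2) by (intro exI[of _ M]) (metis abs_zero less_imp_le)
  qed
  obtain M1 where M1: "M1 \<ge> 0" "\<And>z. \<bar>D z 1\<bar> \<le> M1" using bd[OF DC D0] by blast
  obtain M2 where M2: "M2 \<ge> 0" "\<And>z. \<bar>D z \<i>\<bar> \<le> M2" using bd[OF DC D0] by blast
  have "continuous_on UNIV \<phi>"
    using D has_derivative_continuous by (blast intro: continuous_at_imp_continuous_on)
  then obtain M where M: "\<And>z. \<bar>\<phi> z\<bar> \<le> M" using bd[of \<phi>] zero by blast
  have on: "onorm (D z) \<le> M1 + M2" for z
  proof (rule onorm_le)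
    fix v :: complex
    have lin: "linear (D z)" using D has_derivative_linear by blast
    have "D z v = D z (Re v *\<^sub>R 1 + Im v *\<^sub>R \<i>)"
      by (metis complex_eq mult.commute scaleR_conv_of_real mult.right_neutral)
    also have "\<dots> = Re v * D z 1 + Im v * D z \<i>"
      by (simp add: linear_add[OF lin] linear_scale[OF lin])
    finally have "norm (D z v) \<le> \<bar>Re v\<bar> * \<bar>D z 1\<bar> + \<bar>Im v\<bar> * \<bar>D z \<i>\<bar>"
      using abs_triangle_ineq by (simp add: abs_mult[symmetric])
    also have "\<dots> \<le> norm v * M1 + norm v * M2"
      by (intro add_mono mult_mono M1 M2 abs_Re_le_cmod abs_Im_le_cmod) auto
    finally show "norm (D z v) \<le> (M1 + M2) * norm v" by (simp add: algebra_simps)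
  qed
  have "(M1 + M2)-lipschitz_on UNIV \<phi>"
  proof (rule lipschitz_onI)
    fix x y :: complex
    show "dist (\<phi> x) (\<phi> y) \<le> (M1 + M2) * dist x y"
      unfolding dist_norm
      by (rule differentiable_bound[where S = UNIV and f' = D]) (use D on in auto)
  qed (use M1 M2 in auto)
  with K zero D D0 DC M show thesis
    by (intro that[of K]) (auto simp: D_def)
qed

text \<open>Compact sets have finite measure, so a bound on each of them yields square
  integrability.\<close>

lemma L2_locI:
  assumes "\<And>K. compact K \<Longrightarrow> K \<subseteq> \<Omega> \<Longrightarrow> (\<lambda>z. indicator K z *\<^sub>R h z) \<in> borel_measurable borel"
    and "\<And>K. compact K \<Longrightarrow> K \<subseteq> \<Omega> \<Longrightarrow> \<exists>B. \<forall>z\<in>K. norm (h z) \<le> B"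
  shows "L2_loc \<Omega> h"
  unfolding L2_loc_def
proof (intro allI impI conjI; elim conjE)
  fix K assume K: "compact K" "K \<subseteq> \<Omega>"
  show "set_borel_measurable lebesgue K h"
    unfolding set_borel_measurable_def using assms(1)[OF K] by (simp add: measurable_completion)
  obtain B where B: "\<And>z. z \<in> K \<Longrightarrow> norm (h z) \<le> B" using assms(2)[OF K] by blast
  have eq: "(\<lambda>z. indicator K z *\<^sub>R (cmod (h z))\<^sup>2) = (\<lambda>z. (cmod (indicator K z *\<^sub>R h z))\<^sup>2)"
    by (auto simp: indicator_def)
  have "integrable lborel (\<lambda>z. indicator K z *\<^sub>R (cmod (h z))\<^sup>2)"
  proof (rule integrable_bounded_compact_support[OF _ K(1)])
    show "(\<lambda>z. indicator K z *\<^sub>R (cmod (h z))\<^sup>2) \<in> borel_measurable borel"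
      unfolding eq using assms(1)[OF K] by measurable
    show "norm (indicator K z *\<^sub>R (cmod (h z))\<^sup>2) \<le> B\<^sup>2" if "z \<in> K" for z
      using that B[OF that] by (simp add: power_mono)
  qed auto
  then show "set_integrable lebesgue K (\<lambda>z. (cmod (h z))\<^sup>2)"
    unfolding set_integrable_def by (simp add: integrable_completion)
qed

section \<open>Classical derivatives as weak derivatives\<close>

text \<open>\<open>N\<close> will consist of the unit circle and the origin. The Lipschitz bound is
  required across \<open>N\<close>, which prevents the weak derivative from acquiring a singular
  part there.\<close>

locale almost_differentiable =
  fixes \<Omega> N :: "complex set" and f :: "complex \<Rightarrow> complex" and D :: "complex \<Rightarrow> complex \<Rightarrow> complex"
  assumes open_\<Omega>: "open \<Omega>" and closed_N: "closed N" and null_N: "negligible N"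
    and lip: "lipschitz_on_compacts \<Omega> f"
    and deriv: "\<And>z. z \<in> \<Omega> - N \<Longrightarrow> (f has_derivative D z) (at z)"
begin

text \<open>The candidate for the weak derivative, extended by \<open>0\<close> so as to be a Borel
  function on the whole plane.\<close>

definition "dir v z = (if z \<in> \<Omega> - N then D z v else 0)"

lemma cont: "continuous_on \<Omega> f"
  using lipschitz_on_compacts_continuous_on[OF open_\<Omega> lip] .

text \<open>A pointwise limit of Borel difference quotients. They are formed from the cut-off
  \<open>f0\<close>, because \<open>z + v / (n + 1)\<close> may leave \<open>\<Omega>\<close> for
  small \<open>n\<close> and nothing is known about \<open>f\<close> there.\<close>

lemma dir_measurable: "dir v \<in> borel_measurable borel"
proof -
  define f0 where "f0 z = indicator \<Omega> z *\<^sub>R f z" for z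
  have f0[measurable]: "f0 \<in> borel_measurable borel"
    unfolding f0_def using open_\<Omega> cont by (intro borel_measurable_continuous_on_indicator) auto
  have [measurable]: "\<Omega> - N \<in> sets borel"
    using open_\<Omega> closed_N by auto
  show ?thesis
  proof (rule borel_measurable_LIMSEQ_metric)
    show "(\<lambda>z. indicator (\<Omega> - N) z *\<^sub>R (real (Suc n) *\<^sub>R (f0 (z + v /\<^sub>R real (Suc n)) - f0 z)))
        \<in> borel_measurable borel" for n
      by measurable
    show "(\<lambda>n. indicator (\<Omega> - N) z *\<^sub>R (real (Suc n) *\<^sub>R (f0 (z + v /\<^sub>R real (Suc n)) - f0 z)))
        \<longlonglongrightarrow> dir v z" for z
    proof (cases "z \<in> \<Omega> - N")
      case True
      then have "(f0 has_derivative D z) (at z)"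
        by (intro has_derivative_transform_within_open[OF deriv open_\<Omega>]) (auto simp: f0_def)
      from has_derivative_difference_quotients[OF this] True show ?thesis
        by (simp add: dir_def)
    qed (auto simp: dir_def)
  qed
qed

text \<open>A Lipschitz constant on \<open>K\<close> says nothing about increments that leave
  \<open>K\<close>. On a compact neighbourhood of \<open>K\<close> inside \<open>\<Omega>\<close> it
  bounds all late difference quotients, hence their limit.\<close>

lemma dir_bounded:
  assumes "compact K" "K \<subseteq> \<Omega>"
  obtains B where "\<And>z. norm (dir v z) \<le> B \<or> z \<notin> K"
proof -
  obtain e where e: "e > 0" "(\<Union>x\<in>K. cball x e) \<subseteq> \<Omega>"
    using compact_subset_open_imp_cball_epsilon_subset[OF assms(1) open_\<Omega> assms(2)] .
  define K' where "K' = (\<Union>x\<in>K. cball x e)"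
  \<comment> \<open>As a sum of two compact sets, the thickened set is compact.\<close>
  have "K' = {x + y |x y. x \<in> K \<and> y \<in> cball 0 e}"
  proof (intro equalityI subsetI)
    fix w assume "w \<in> K'"
    then obtain x where "x \<in> K" "dist x w \<le> e" by (auto simp: K'_def)
    then have "x \<in> K" "w - x \<in> cball 0 e" "w = x + (w - x)"
      by (auto simp: dist_norm norm_minus_commute)
    then show "w \<in> {x + y |x y. x \<in> K \<and> y \<in> cball 0 e}" by blast
  next
    fix w assume "w \<in> {x + y |x y. x \<in> K \<and> y \<in> cball 0 e}"
    then obtain x y where "x \<in> K" "y \<in> cball 0 e" "w = x + y" by blast
    then show "w \<in> K'" unfolding K'_def by (intro UN_I[of x]) (auto simp: dist_norm)
  qed
  then have "compact K'"
    using compact_sums[OF assms(1) compact_cball[of 0 e]] by simp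
  then obtain L where L: "L-lipschitz_on K' f"
    using lipschitz_on_compactsE[OF lip] e K'_def by metis
  have "norm (dir v z) \<le> L * norm v" if "z \<in> K" for z
  proof (cases "z \<in> \<Omega> - N")
    case True
    note lim = has_derivative_difference_quotients[OF deriv[OF True], of v]
    have "(\<lambda>n. inverse (real (Suc n)) *\<^sub>R v) \<longlonglongrightarrow> 0 *\<^sub>R v"
      by (intro tendsto_scaleR tendsto_const LIMSEQ_inverse_real_of_nat)
    then have "\<forall>\<^sub>F n in sequentially. norm (v /\<^sub>R real (Suc n)) < e"
      using e by (auto dest: tendstoD simp: dist_norm)
    then have "\<forall>\<^sub>F n in sequentially.
        norm (real (Suc n) *\<^sub>R (f (z + v /\<^sub>R real (Suc n)) - f z)) \<le> L * norm v"
    proof eventually_elim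
      case (elim n)
      then have "z + v /\<^sub>R real (Suc n) \<in> K'" "z \<in> K'"
        using \<open>z \<in> K\<close> e unfolding K'_def by (auto simp: dist_norm intro!: bexI[of _ z])
      then have "norm (f (z + v /\<^sub>R real (Suc n)) - f z) \<le> L * norm (v /\<^sub>R real (Suc n))"
        using lipschitz_onD[OF L, of "z + v /\<^sub>R real (Suc n)" z] by (simp add: dist_norm)
      then have "real (Suc n) * norm (f (z + v /\<^sub>R real (Suc n)) - f z)
         \<le> real (Suc n) * (L * norm (v /\<^sub>R real (Suc n)))"
        by (intro mult_left_mono) auto
      also have "\<dots> = L * norm v" by (simp add: field_simps del: of_nat_Suc)
      finally show ?case by (simp del: of_nat_Suc)
    qed
    with lim have "norm (D z v) \<le> L * norm v"
      by (intro Lim_norm_ubound[of sequentially]) auto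
    with True show ?thesis by (auto simp: dir_def)
  next
    case False
    then show ?thesis
      using lipschitz_on_nonneg[OF L] by (auto simp: dir_def)
  qed
  then show thesis using that by blast
qed

lemma weak_derivative: "weak_directional_derivative \<Omega> v f (dir v)"
  unfolding weak_directional_derivative_def
proof
  fix \<phi> assume "\<phi> \<in> test_functions \<Omega>"
  then obtain K L M where K: "compact K" "K \<subseteq> \<Omega>" and zero: "\<And>z. z \<notin> K \<Longrightarrow> \<phi> z = 0"
    and d\<phi>: "\<And>z. (\<phi> has_derivative frechet_derivative \<phi> (at z)) (at z)"
    and d0: "\<And>z v. z \<notin> K \<Longrightarrow> frechet_derivative \<phi> (at z) v = 0"
    and dC: "\<And>v. continuous_on UNIV (\<lambda>z. frechet_derivative \<phi> (at z) v)"
    and L: "L-lipschitz_on UNIV \<phi>" and M: "\<And>z. \<bar>\<phi> z\<bar> \<le> M"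
    by (rule test_functionE) blast
  define D\<phi> where "D\<phi> z = frechet_derivative \<phi> (at z) v" for z
  obtain Lf where Lf: "Lf-lipschitz_on K f"
    using lipschitz_on_compactsE[OF lip K] by metis
  have fK: "continuous_on K f" using cont K continuous_on_subset by blast
  then have "bounded (f ` K)" using K compact_continuous_image compact_imp_bounded by blast
  then obtain Mf where Mf: "Mf > 0" "\<And>z. z \<in> K \<Longrightarrow> norm (f z) \<le> Mf"
    unfolding bounded_pos by auto
  have L0: "L \<ge> 0" "Lf \<ge> 0" using L Lf lipschitz_on_nonneg by auto
  have M0: "M \<ge> 0" using M[of 0] by linarith
  have \<phi>L: "\<bar>\<phi> x - \<phi> y\<bar> \<le> L * norm (x - y)" for x y
    using lipschitz_onD[OF L, of x y] by (simp add: dist_norm)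
  define \<psi> where "\<psi> z = \<phi> z *\<^sub>R f z" for z
  \<comment> \<open>\<open>f\<close> is controlled only on \<open>K\<close>. If \<open>y\<close>
    lies outside, then \<open>\<phi> y = 0\<close> and the value \<open>f y\<close> drops out, so a
    Lipschitz estimate results although \<open>f\<close> may be wild at \<open>y\<close>.\<close>
  have one: "norm (\<psi> x - \<psi> y) \<le> (L * Mf + M * Lf) * norm (x - y)" if "x \<in> K" for x y
  proof (cases "y \<in> K")
    case True
    have "\<psi> x - \<psi> y = (\<phi> x - \<phi> y) *\<^sub>R f x + \<phi> y *\<^sub>R (f x - f y)"
      by (simp add: \<psi>_def algebra_simps)
    then have "norm (\<psi> x - \<psi> y) \<le> \<bar>\<phi> x - \<phi> y\<bar> * norm (f x) + \<bar>\<phi> y\<bar> * norm (f x - f y)"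
      using norm_triangle_ineq by (metis norm_scaleR)
    also have "\<dots> \<le> (L * norm (x - y)) * Mf + M * (Lf * norm (x - y))"
      using lipschitz_onD[OF Lf that True] L0 M0
      by (intro add_mono mult_mono \<phi>L M Mf that) (auto simp: dist_norm)
    finally show ?thesis by (simp add: algebra_simps)
  next
    case False
    then have "norm (\<psi> x - \<psi> y) = \<bar>\<phi> x - \<phi> y\<bar> * norm (f x)"
      by (simp add: \<psi>_def zero)
    also have "\<dots> \<le> (L * norm (x - y)) * Mf"
      using L0 by (intro mult_mono \<phi>L Mf that) auto
    also have "\<dots> \<le> (L * Mf + M * Lf) * norm (x - y)"
      using L0 M0 by (simp add: algebra_simps)
    finally show ?thesis .
  qed
  have lip\<psi>: "(L * Mf + M * Lf)-lipschitz_on UNIV \<psi>"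
  proof (rule lipschitz_onI)
    show "0 \<le> L * Mf + M * Lf" using L0 M0 Mf by auto
    fix x y
    consider "x \<in> K" | "y \<in> K" | "x \<notin> K" "y \<notin> K" by blast
    then show "dist (\<psi> x) (\<psi> y) \<le> (L * Mf + M * Lf) * dist x y"
    proof cases
      case 2
      then show ?thesis using one[of y x] by (simp add: dist_norm norm_minus_commute)
    qed (use one \<open>0 \<le> L * Mf + M * Lf\<close> in \<open>auto simp: dist_norm \<psi>_def zero\<close>)
  qed
  \<comment> \<open>\<open>A\<close> and \<open>B\<close> are the two terms of the product rule for
    \<open>\<psi>\<close>; that their integrals cancel is the claim, since both vanish off
    \<open>K\<close>.\<close>
  define A where "A z = D\<phi> z *\<^sub>R f z" for z
  define B where "B z = \<phi> z *\<^sub>R dir v z" for z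
  have "A = (\<lambda>z. indicator K z *\<^sub>R (D\<phi> z *\<^sub>R f z))"
  proof
    show "A z = indicator K z *\<^sub>R (D\<phi> z *\<^sub>R f z)" for z
      by (cases "z \<in> K") (simp_all add: A_def D\<phi>_def d0)
  qed
  moreover have D\<phi>C: "continuous_on S D\<phi>" for S
    using dC continuous_on_subset unfolding D\<phi>_def by blast
  then have "(\<lambda>z. indicator K z *\<^sub>R (D\<phi> z *\<^sub>R f z)) \<in> borel_measurable borel"
    using K fK by (intro borel_measurable_continuous_on_indicator continuous_on_scaleR borel_compact)
  ultimately have Am: "A \<in> borel_measurable borel" by (simp only:)
  have "\<phi> \<in> borel_measurable borel"
    using L lipschitz_on_continuous_on borel_measurable_continuous_onI by blast
  then have Bm: "B \<in> borel_measurable borel"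
    unfolding B_def using dir_measurable by measurable
  have "bounded (D\<phi> ` K)" using D\<phi>C K compact_continuous_image compact_imp_bounded by blast
  then obtain Md where Md: "Md > 0" "\<And>z. z \<in> K \<Longrightarrow> norm (D\<phi> z) \<le> Md"
    unfolding bounded_pos by auto
  obtain Bd where Bd: "\<And>z. norm (dir v z) \<le> Bd \<or> z \<notin> K" using dir_bounded[OF K] by blast
  have Ai: "integrable lborel A"
  proof (rule integrable_bounded_compact_support[OF Am K(1)])
    show "norm (A z) \<le> Md * Mf" if "z \<in> K" for z
      using that Md Mf by (auto simp: A_def intro!: mult_mono)
  qed (simp add: A_def D\<phi>_def d0)
  have Bi: "integrable lborel B"
  proof (rule integrable_bounded_compact_support[OF Bm K(1)])
    show "norm (B z) \<le> M * Bd" if "z \<in> K" for z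
      using that Bd[of z] M[of z] M0 by (auto simp: B_def intro!: mult_mono)
  qed (simp add: B_def zero)
  have "(\<integral>z. A z + B z \<partial>lborel) = 0"
  proof (rule integral_directional_derivative_eq_0[OF lip\<psi> K(1)])
    show "\<psi> z = 0" if "z \<notin> K" for z using that by (simp add: \<psi>_def zero)
    show "(\<lambda>z. A z + B z) \<in> borel_measurable borel" using Am Bm by measurable
    have "N \<in> null_sets lborel"
      using null_N closed_N by (simp add: negligible_iff_null_sets null_sets_completion_iff)
    then have "AE z in lborel. z \<notin> N" by (rule AE_not_in)
    then show "AE z in lborel. (\<lambda>n. real (Suc n) *\<^sub>R (\<psi> (z + v /\<^sub>R real (Suc n)) - \<psi> z)) \<longlonglongrightarrow> A z + B z"
    proof eventually_elim
      case (elim z)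
      show ?case
      proof (cases "z \<in> \<Omega>")
        case True
        with elim have "(f has_derivative D z) (at z)" by (intro deriv) auto
        then have "(\<psi> has_derivative (\<lambda>v. \<phi> z *\<^sub>R D z v + frechet_derivative \<phi> (at z) v *\<^sub>R f z)) (at z)"
          unfolding \<psi>_def using d\<phi> by (intro has_derivative_scaleR)
        from has_derivative_difference_quotients[OF this, of v] show ?thesis
          using True elim by (simp add: A_def B_def dir_def D\<phi>_def add.commute)
      next
        case False
        then have "z \<notin> K" using K by auto
        have "(\<psi> has_derivative (\<lambda>v. 0)) (at z)"
          by (rule has_derivative_transform_within_open[OF has_derivative_const, where s = "- K"])
            (use \<open>z \<notin> K\<close> zero K compact_imp_closed in \<open>auto simp: \<psi>_def\<close>)
        from has_derivative_difference_quotients[OF this, of v] show ?thesis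
          using \<open>z \<notin> K\<close> by (simp add: A_def B_def zero D\<phi>_def d0)
      qed
    qed
  qed
  then have "(\<integral>z. A z \<partial>lborel) = - (\<integral>z. B z \<partial>lborel)"
    using Ai Bi by (simp add: eq_neg_iff_add_eq_0)
  moreover have "(LINT z:\<Omega>|lebesgue. A z) = (\<integral>z. A z \<partial>lborel)"
  proof -
    have "(\<lambda>z. indicator \<Omega> z *\<^sub>R A z) = A"
    proof
      show "indicator \<Omega> z *\<^sub>R A z = A z" for z
        using K by (cases "z \<in> K") (auto simp: A_def D\<phi>_def d0)
    qed
    then show ?thesis
      unfolding set_lebesgue_integral_def using Am by (simp add: integral_completion)
  qed
  moreover have "(LINT z:\<Omega>|lebesgue. B z) = (\<integral>z. B z \<partial>lborel)"
  proof -
    have "(\<lambda>z. indicator \<Omega> z *\<^sub>R B z) = B"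
    proof
      show "indicator \<Omega> z *\<^sub>R B z = B z" for z
        using K by (cases "z \<in> K") (auto simp: B_def zero)
    qed
    then show ?thesis
      unfolding set_lebesgue_integral_def using Bm by (simp add: integral_completion)
  qed
  ultimately show "(LINT z:\<Omega>|lebesgue. frechet_derivative \<phi> (at z) v *\<^sub>R f z)
          = - (LINT z:\<Omega>|lebesgue. \<phi> z *\<^sub>R dir v z)"
    by (simp add: A_def[symmetric] B_def[symmetric] D\<phi>_def[symmetric])
qed

lemma W12_loc_dir: "W12_loc \<Omega> f (dir 1) (dir \<i>)"
  unfolding W12_loc_def
proof (intro conjI weak_derivative)
  show "L2_loc \<Omega> f"
  proof (rule L2_locI)
    fix K assume K: "compact K" "K \<subseteq> \<Omega>"
    then have fK: "continuous_on K f" using cont continuous_on_subset by blast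
    then show "(\<lambda>z. indicator K z *\<^sub>R f z) \<in> borel_measurable borel"
      using K by (intro borel_measurable_continuous_on_indicator borel_compact)
    have "bounded (f ` K)" using fK K compact_continuous_image compact_imp_bounded by blast
    then show "\<exists>B. \<forall>z\<in>K. norm (f z) \<le> B" unfolding bounded_iff by auto
  qed
  have "L2_loc \<Omega> (dir v)" for v
  proof (rule L2_locI)
    fix K assume K: "compact K" "K \<subseteq> \<Omega>"
    then have "K \<in> sets borel" by (simp add: borel_compact)
    then show "(\<lambda>z. indicator K z *\<^sub>R dir v z) \<in> borel_measurable borel"
      using dir_measurable by measurable
    show "\<exists>B. \<forall>z\<in>K. norm (dir v z) \<le> B" using dir_bounded[OF K] by metis
  qed
  then show "L2_loc \<Omega> (dir 1)" "L2_loc \<Omega> (dir \<i>)" by simp_all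
qed

end

text \<open>In the form \<open>a * v + b * cnj v\<close> the coefficients are the Wirtinger
  derivatives: the values at \<open>1\<close> and \<open>\<i>\<close> combine to
  \<open>2 * b\<close> and \<open>2 * a\<close>, so the inequality off \<open>N\<close> is the
  dilatation bound almost everywhere.\<close>

lemma beltrami_W12_loc:
  assumes "open \<Omega>" "closed N" "negligible N" "lipschitz_on_compacts \<Omega> f"
    and D: "\<And>z. z \<in> \<Omega> - N \<Longrightarrow>
      \<exists>a b. (f has_derivative (\<lambda>v. a * v + b * cnj v)) (at z) \<and> cmod b \<le> k * cmod a"
  shows "\<exists>f\<^sub>x f\<^sub>y. W12_loc \<Omega> f f\<^sub>x f\<^sub>y \<and>
    (AE z in lebesgue. z \<in> \<Omega> \<longrightarrow>
       cmod ((f\<^sub>x z + \<i> * f\<^sub>y z) / 2) \<le> k * cmod ((f\<^sub>x z - \<i> * f\<^sub>y z) / 2))"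
proof -
  obtain a b where ab: "\<And>z. z \<in> \<Omega> - N \<Longrightarrow>
      (f has_derivative (\<lambda>v. a z * v + b z * cnj v)) (at z) \<and> cmod (b z) \<le> k * cmod (a z)"
    using D by metis
  interpret almost_differentiable \<Omega> N f "\<lambda>z v. a z * v + b z * cnj v"
    by unfold_locales (use assms ab in auto)
  have "AE z in lebesgue. z \<notin> N"
    using assms(3) by (intro AE_not_in) (simp add: negligible_iff_null_sets)
  then have "AE z in lebesgue. z \<in> \<Omega> \<longrightarrow>
       cmod ((dir 1 z + \<i> * dir \<i> z) / 2) \<le> k * cmod ((dir 1 z - \<i> * dir \<i> z) / 2)"
  proof eventually_elim
    case (elim z)
    show ?case
    proof
      assume "z \<in> \<Omega>"
      with elim have dir: "dir v z = a z * v + b z * cnj v" for v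
        by (simp add: dir_def)
      have "dir 1 z + \<i> * dir \<i> z = 2 * b z" "dir 1 z - \<i> * dir \<i> z = 2 * a z"
        unfolding dir by (simp_all add: algebra_simps)
      then show "cmod ((dir 1 z + \<i> * dir \<i> z) / 2) \<le> k * cmod ((dir 1 z - \<i> * dir \<i> z) / 2)"
        using ab[of z] elim \<open>z \<in> \<Omega>\<close> by simp
    qed
  qed
  then show ?thesis using W12_loc_dir by blast
qed

section \<open>Beltrami coefficients and local index\<close>

lemma lipschitz_on_compacts_transform:
  assumes "lipschitz_on_compacts \<Omega> f" "\<And>z. z \<in> \<Omega> \<Longrightarrow> g z = f z"
  shows "lipschitz_on_compacts \<Omega> g"
  unfolding lipschitz_on_compacts_def
proof (intro allI impI)
  fix K assume K: "compact K \<and> K \<subseteq> \<Omega>"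
  then obtain L where "L-lipschitz_on K f"
    using lipschitz_on_compactsE[OF assms(1)] by metis
  then have "L-lipschitz_on K g"
    by (rule lipschitz_on_transform) (use K assms(2) in auto)
  then show "\<exists>L. L-lipschitz_on K g" ..
qed

text \<open>A compact set missing \<open>0\<close> keeps a positive distance from it.\<close>

lemma lipschitz_on_compactsI:
  assumes "\<And>\<delta>. 0 < \<delta> \<Longrightarrow> \<exists>L. L-lipschitz_on {z. \<delta> \<le> cmod z} f"
  shows "lipschitz_on_compacts (- {0}) f"
  unfolding lipschitz_on_compacts_def
proof (intro allI impI)
  fix K :: "complex set" assume K: "compact K \<and> K \<subseteq> - {0}"
  then have "open (- K)" "0 \<in> - K" using compact_imp_closed by auto
  then obtain \<delta> where \<delta>: "0 < \<delta>" "ball 0 \<delta> \<subseteq> - K" using open_contains_ball by blast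
  then have "K \<subseteq> {z. \<delta> \<le> cmod z}" by (force simp: subset_iff)
  with assms[OF \<delta>(1)] show "\<exists>L. L-lipschitz_on K f"
    using lipschitz_on_subset by metis
qed

lemma lipschitz_on_inverse_norm_ge:
  assumes "0 < \<delta>"
  shows "(1 / \<delta>\<^sup>2)-lipschitz_on {z. \<delta> \<le> cmod z} (\<lambda>z. 1 / z)"
proof (rule lipschitz_onI)
  fix z w assume "z \<in> {z. \<delta> \<le> cmod z}" "w \<in> {z. \<delta> \<le> cmod z}"
  then have zw: "\<delta> \<le> cmod z" "\<delta> \<le> cmod w" by auto
  then have "z \<noteq> 0" "w \<noteq> 0" using assms by auto
  then have "dist (1 / z) (1 / w) = cmod (z - w) / (cmod z * cmod w)"
    by (simp add: dist_norm diff_frac_eq norm_divide norm_mult norm_minus_commute)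
  also have "\<dots> \<le> cmod (z - w) / \<delta>\<^sup>2"
    unfolding power2_eq_square using assms zw by (intro divide_left_mono mult_mono) (auto intro!: mult_pos_pos)
  finally show "dist (1 / z) (1 / w) \<le> 1 / \<delta>\<^sup>2 * dist z w"
    by (simp add: dist_norm)
qed (use assms in auto)

section \<open>The Beltrami inequality under holomorphic changes of coordinates\<close>

text \<open>The real-linear derivative is given by its Wirtinger coefficients because holomorphic
  maps act on them simply: composition from the left multiplies both by the same number.\<close>

definition beltrami_at :: "real \<Rightarrow> (complex \<Rightarrow> complex) \<Rightarrow> complex \<Rightarrow> bool" where
  "beltrami_at k f z \<longleftrightarrow>
     (\<exists>a b. (f has_derivative (\<lambda>v. a * v + b * cnj v)) (at z) \<and> cmod b \<le> k * cmod a)"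

lemma beltrami_at_transform:
  assumes "beltrami_at k f z" "open S" "z \<in> S" "\<And>w. w \<in> S \<Longrightarrow> f w = g w"
  shows "beltrami_at k g z"
proof -
  obtain a b where ab: "(f has_derivative (\<lambda>v. a * v + b * cnj v)) (at z)" "cmod b \<le> k * cmod a"
    using assms(1) unfolding beltrami_at_def by blast
  then have "(g has_derivative (\<lambda>v. a * v + b * cnj v)) (at z)"
    using has_derivative_transform_within_open[OF ab(1) assms(2-4)] by blast
  with ab(2) show ?thesis unfolding beltrami_at_def by blast
qed

lemma beltrami_at_compose_left:
  assumes "beltrami_at k f z" "(\<tau> has_field_derivative T) (at (f z))"
  shows "beltrami_at k (\<lambda>w. \<tau> (f w)) z"
proof -
  obtain a b where ab: "(f has_derivative (\<lambda>v. a * v + b * cnj v)) (at z)" "cmod b \<le> k * cmod a"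
    using assms(1) unfolding beltrami_at_def by blast
  have "((\<lambda>w. \<tau> (f w)) has_derivative (\<lambda>v. T * (a * v + b * cnj v))) (at z)"
    using has_derivative_compose[OF ab(1)] assms(2) unfolding has_field_derivative_def by blast
  moreover have "(\<lambda>v. T * (a * v + b * cnj v)) = (\<lambda>v. (T * a) * v + (T * b) * cnj v)"
    by (simp add: algebra_simps)
  moreover have "cmod (T * b) \<le> k * cmod (T * a)"
    using mult_left_mono[OF ab(2), of "cmod T"] by (simp add: norm_mult mult.left_commute)
  ultimately show ?thesis
    unfolding beltrami_at_def by (intro exI[of _ "T * a"] exI[of _ "T * b"]) simp
qed

text \<open>The chain rule multiplies \<open>a\<close> by \<open>S\<close> and \<open>b\<close> by
  \<open>cnj S\<close>, which have equal modulus.\<close>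

lemma beltrami_at_compose_right:
  assumes "beltrami_at k f (\<sigma> z)" "(\<sigma> has_field_derivative S) (at z)"
  shows "beltrami_at k (\<lambda>w. f (\<sigma> w)) z"
proof -
  obtain a b where ab: "(f has_derivative (\<lambda>v. a * v + b * cnj v)) (at (\<sigma> z))" "cmod b \<le> k * cmod a"
    using assms(1) unfolding beltrami_at_def by blast
  have "((\<lambda>w. f (\<sigma> w)) has_derivative (\<lambda>v. a * (S * v) + b * cnj (S * v))) (at z)"
    by (rule has_derivative_compose[OF assms(2)[unfolded has_field_derivative_def] ab(1)])
  moreover have "(\<lambda>v. a * (S * v) + b * cnj (S * v)) = (\<lambda>v. (a * S) * v + (b * cnj S) * cnj v)"
    by (simp add: algebra_simps)
  moreover have "cmod (b * cnj S) \<le> k * cmod (a * S)"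
    using mult_right_mono[OF ab(2), of "cmod S"] by (simp add: norm_mult mult.assoc)
  ultimately show ?thesis
    unfolding beltrami_at_def by (intro exI[of _ "a * S"] exI[of _ "b * cnj S"]) simp
qed

text \<open>A topological substitute for an orientation-preserving invertible derivative.\<close>

definition nearly_linear :: "(complex \<Rightarrow> complex) \<Rightarrow> complex \<Rightarrow> bool" where
  "nearly_linear \<Phi> z \<longleftrightarrow> (\<exists>A q. A \<noteq> 0 \<and> 0 \<le> q \<and> q < 1 \<and>
     (\<forall>\<^sub>F w in nhds z. cmod (\<Phi> w - \<Phi> z - A * (w - z)) \<le> q * cmod A * cmod (w - z)))"

lemma nearly_linear_transform:
  assumes "nearly_linear f z" "open S" "z \<in> S" "\<And>w. w \<in> S \<Longrightarrow> g w = f w"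
  shows "nearly_linear g z"
proof -
  obtain A q where A: "A \<noteq> 0" "0 \<le> q" "q < 1"
    "\<forall>\<^sub>F w in nhds z. cmod (f w - f z - A * (w - z)) \<le> q * cmod A * cmod (w - z)"
    using assms(1) unfolding nearly_linear_def by blast
  have "\<forall>\<^sub>F w in nhds z. w \<in> S" using assms eventually_nhds by blast
  with A(4) have "\<forall>\<^sub>F w in nhds z. cmod (g w - g z - A * (w - z)) \<le> q * cmod A * cmod (w - z)"
    by eventually_elim (use assms in simp)
  with A show ?thesis unfolding nearly_linear_def by blast
qed

lemma has_field_derivative_eventually_le:
  assumes "(f has_field_derivative D) (at z)" "0 < e"
  shows "\<forall>\<^sub>F w in nhds z. cmod (f w - f z - D * (w - z)) \<le> e * cmod (w - z)"
proof -
  obtain d where "0 < d"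
    "\<And>w. cmod (w - z) < d \<Longrightarrow> cmod (f w - f z - D * (w - z)) \<le> e * cmod (w - z)"
    using assms unfolding has_field_derivative_def has_derivative_at_alt by metis
  then show ?thesis unfolding eventually_nhds_metric dist_norm by blast
qed

text \<open>The relative error \<open>q\<close> of \<open>f\<close> is fixed below \<open>1\<close>,
  while that of the differentiable map \<open>\<tau>\<close> can be made as small as desired, so the
  errors together stay below \<open>1\<close>.\<close>

lemma nearly_linear_compose_left:
  assumes "nearly_linear f z" "(\<tau> has_field_derivative T) (at (f z))" "T \<noteq> 0" "isCont f z"
  shows "nearly_linear (\<lambda>w. \<tau> (f w)) z"
proof -
  obtain A q where A: "A \<noteq> 0" "0 \<le> q" "q < 1"
    and f: "\<forall>\<^sub>F w in nhds z. cmod (f w - f z - A * (w - z)) \<le> q * cmod A * cmod (w - z)"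
    using assms(1) unfolding nearly_linear_def by blast
  \<comment> \<open>The total relative error comes to \<open>q + e * (1 + q)\<close>; this
    \<open>e\<close> makes it the midpoint of \<open>q\<close> and \<open>1\<close>.\<close>
  define e where "e = (1 - q) / (2 * (1 + q))"
  have e: "0 < e" "q + e * (1 + q) = (1 + q) / 2"
    using A by (auto simp: e_def field_simps)
  have "\<forall>\<^sub>F u in nhds (f z). cmod (\<tau> u - \<tau> (f z) - T * (u - f z)) \<le> e * cmod T * cmod (u - f z)"
    using assms e by (intro has_field_derivative_eventually_le) auto
  moreover have "filterlim f (nhds (f z)) (nhds z)"
    using assms(4) by (simp add: isCont_def tendsto_nhds_iff)
  ultimately have "\<forall>\<^sub>F w in nhds z. cmod (\<tau> (f w) - \<tau> (f z) - T * (f w - f z)) \<le> e * cmod T * cmod (f w - f z)"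
    by (rule eventually_compose_filterlim)
  with f have "\<forall>\<^sub>F w in nhds z. cmod (\<tau> (f w) - \<tau> (f z) - (T * A) * (w - z))
      \<le> (1 + q) / 2 * cmod (T * A) * cmod (w - z)"
  proof eventually_elim
    case (elim w)
    have "cmod (f w - f z) = cmod ((f w - f z - A * (w - z)) + A * (w - z))" by simp
    also have "\<dots> \<le> cmod (f w - f z - A * (w - z)) + cmod (A * (w - z))"
      by (rule norm_triangle_ineq)
    also have "\<dots> \<le> (1 + q) * cmod A * cmod (w - z)"
      using elim(1) by (simp add: norm_mult distrib_right mult.assoc)
    finally have 1: "cmod (f w - f z) \<le> (1 + q) * cmod A * cmod (w - z)" .
    have "cmod (\<tau> (f w) - \<tau> (f z) - (T * A) * (w - z))
      = cmod ((\<tau> (f w) - \<tau> (f z) - T * (f w - f z)) + T * (f w - f z - A * (w - z)))"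
      by (simp add: algebra_simps)
    also have "\<dots> \<le> cmod (\<tau> (f w) - \<tau> (f z) - T * (f w - f z)) + cmod T * cmod (f w - f z - A * (w - z))"
      by (metis norm_triangle_ineq norm_mult)
    also have "\<dots> \<le> e * cmod T * ((1 + q) * cmod A * cmod (w - z)) + cmod T * (q * cmod A * cmod (w - z))"
      using elim 1 e by (intro add_mono order_trans[OF elim(2)] mult_left_mono) auto
    also have "\<dots> = (q + e * (1 + q)) * cmod (T * A) * cmod (w - z)"
      by (simp add: norm_mult algebra_simps)
    finally show ?case by (simp add: e(2))
  qed
  moreover have "0 \<le> (1 + q) / 2" "(1 + q) / 2 < 1" "T * A \<noteq> 0" using A assms by auto
  ultimately show ?thesis unfolding nearly_linear_def by blast
qed

text \<open>Here the errors add up to \<open>q * (1 + e) + e\<close>, the same sum as for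
  composition from the left, so the same \<open>e\<close> serves.\<close>

lemma nearly_linear_compose_right:
  assumes "nearly_linear f (\<sigma> z)" "(\<sigma> has_field_derivative S) (at z)" "S \<noteq> 0"
  shows "nearly_linear (\<lambda>w. f (\<sigma> w)) z"
proof -
  obtain A q where A: "A \<noteq> 0" "0 \<le> q" "q < 1"
    and f: "\<forall>\<^sub>F u in nhds (\<sigma> z). cmod (f u - f (\<sigma> z) - A * (u - \<sigma> z)) \<le> q * cmod A * cmod (u - \<sigma> z)"
    using assms(1) unfolding nearly_linear_def by blast
  define e where "e = (1 - q) / (2 * (1 + q))"
  have e: "0 < e" "q + e * (1 + q) = (1 + q) / 2"
    using A by (auto simp: e_def field_simps)
  have "filterlim \<sigma> (nhds (\<sigma> z)) (nhds z)"
    using DERIV_isCont[OF assms(2)] by (simp add: isCont_def tendsto_nhds_iff)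
  with f have "\<forall>\<^sub>F w in nhds z. cmod (f (\<sigma> w) - f (\<sigma> z) - A * (\<sigma> w - \<sigma> z)) \<le> q * cmod A * cmod (\<sigma> w - \<sigma> z)"
    by (rule eventually_compose_filterlim)
  moreover have "\<forall>\<^sub>F w in nhds z. cmod (\<sigma> w - \<sigma> z - S * (w - z)) \<le> e * cmod S * cmod (w - z)"
    using assms e by (intro has_field_derivative_eventually_le) auto
  ultimately have "\<forall>\<^sub>F w in nhds z. cmod (f (\<sigma> w) - f (\<sigma> z) - (A * S) * (w - z))
      \<le> (1 + q) / 2 * cmod (A * S) * cmod (w - z)"
  proof eventually_elim
    case (elim w)
    have "cmod (\<sigma> w - \<sigma> z) = cmod ((\<sigma> w - \<sigma> z - S * (w - z)) + S * (w - z))" by simp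
    also have "\<dots> \<le> cmod (\<sigma> w - \<sigma> z - S * (w - z)) + cmod (S * (w - z))"
      by (rule norm_triangle_ineq)
    also have "\<dots> \<le> (1 + e) * cmod S * cmod (w - z)"
      using elim(2) by (simp add: norm_mult distrib_right mult.assoc)
    finally have 1: "cmod (\<sigma> w - \<sigma> z) \<le> (1 + e) * cmod S * cmod (w - z)" .
    have "cmod (f (\<sigma> w) - f (\<sigma> z) - (A * S) * (w - z))
      = cmod ((f (\<sigma> w) - f (\<sigma> z) - A * (\<sigma> w - \<sigma> z)) + A * (\<sigma> w - \<sigma> z - S * (w - z)))"
      by (simp add: algebra_simps)
    also have "\<dots> \<le> cmod (f (\<sigma> w) - f (\<sigma> z) - A * (\<sigma> w - \<sigma> z)) + cmod A * cmod (\<sigma> w - \<sigma> z - S * (w - z))"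
      by (metis norm_triangle_ineq norm_mult)
    also have "\<dots> \<le> q * cmod A * ((1 + e) * cmod S * cmod (w - z)) + cmod A * (e * cmod S * cmod (w - z))"
      using elim 1 A by (intro add_mono order_trans[OF elim(1)] mult_left_mono) auto
    also have "\<dots> = (q + e * (1 + q)) * cmod (A * S) * cmod (w - z)"
      by (simp add: norm_mult algebra_simps)
    finally show ?case by (simp add: e(2))
  qed
  moreover have "0 \<le> (1 + q) / 2" "(1 + q) / 2 < 1" "A * S \<noteq> 0" using A assms by auto
  ultimately show ?thesis unfolding nearly_linear_def by blast
qed

section \<open>Winding numbers of images of small circles\<close>

text \<open>After translation to the origin, the factor \<open>A\<close> cancels in the logarithmic
  derivative of the path, leaving the integral over a round circle.\<close>

lemma winding_number_linear_image_circle: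
  assumes "A \<noteq> 0" "0 < r"
  shows "winding_number (\<lambda>t. c + A * (circlepath z r t - z)) c = 1"
proof -
  define p where "p = (\<lambda>t. A * circlepath 0 r t)"
  have dc: "(circlepath 0 r has_vector_derivative vector_derivative (circlepath 0 r) (at t)) (at t)" for t
    using has_vector_derivative_part_circlepath[of 0 r 0 "2 * pi" t "UNIV"]
    by (metis circlepath_def vector_derivative_at)
  have dp: "(p has_vector_derivative A * vector_derivative (circlepath 0 r) (at t)) (at t)" for t
    unfolding p_def by (rule has_vector_derivative_mult_right[OF dc])
  have vp: "valid_path p"
    unfolding p_def using valid_path_compose_holomorphic[of "circlepath 0 r" "(*) A" UNIV]
    by (auto simp: o_def intro!: holomorphic_intros)
  have p0: "0 \<notin> path_image p"
    using assms by (auto simp: p_def path_image_def circlepath)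
  have "1 / (p t - 0) * vector_derivative p (at t)
      = 1 / (circlepath 0 r t - 0) * vector_derivative (circlepath 0 r) (at t)" for t
    unfolding vector_derivative_at[OF dp] using assms by (simp add: p_def)
  then have "contour_integral p (\<lambda>w. 1 / (w - 0)) = contour_integral (circlepath 0 r) (\<lambda>w. 1 / (w - 0))"
    unfolding contour_integral_integral
    by (intro integral_cong) simp
  then have "winding_number p 0 = winding_number (circlepath 0 r) 0"
    using vp p0 assms by (simp add: winding_number_valid_path)
  then have "winding_number p 0 = 1"
    using assms by (simp add: winding_number_circlepath_centre)
  moreover have "(\<lambda>t. c + A * (circlepath z r t - z) - c) = p"
    by (auto simp: p_def circlepath)
  ultimately show ?thesis
    using winding_number_offset[of "\<lambda>t. c + A * (circlepath z r t - z)" c] by simp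
qed

text \<open>A leash argument: on the circle of radius \<open>r\<close> the image differs from the
  linear model by at most \<open>q * cmod A * r\<close>, which is less than the distance
  \<open>cmod A * r\<close> of the model from \<open>\<Phi> z\<close>. Hence the two loops are
  homotopic in the complement of \<open>\<Phi> z\<close>.\<close>

lemma nearly_linear_winding_number:
  assumes "open S" "z \<in> S" "continuous_on S \<Phi>" "nearly_linear \<Phi> z"
  shows "\<forall>\<^sub>F r in at_right 0. winding_number (\<Phi> \<circ> circlepath z r) (\<Phi> z) = 1"
proof -
  obtain A q where A: "A \<noteq> 0" "0 \<le> q" "q < 1"
    and ev: "\<forall>\<^sub>F w in nhds z. cmod (\<Phi> w - \<Phi> z - A * (w - z)) \<le> q * cmod A * cmod (w - z)"
    using assms(4) unfolding nearly_linear_def by blast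
  have "\<forall>\<^sub>F w in nhds z. w \<in> S" using assms eventually_nhds by blast
  with ev have "\<forall>\<^sub>F w in nhds z. w \<in> S \<and> cmod (\<Phi> w - \<Phi> z - A * (w - z)) \<le> q * cmod A * cmod (w - z)"
    by eventually_elim simp
  then obtain d where d: "0 < d" "\<And>w. dist w z < d \<Longrightarrow>
      w \<in> S \<and> cmod (\<Phi> w - \<Phi> z - A * (w - z)) \<le> q * cmod A * cmod (w - z)"
    unfolding eventually_nhds_metric by blast
  have main: "winding_number (\<Phi> \<circ> circlepath z r) (\<Phi> z) = 1" if r: "0 < r" "r < d" for r
  proof -
    let ?g = "\<lambda>t. \<Phi> z + A * (circlepath z r t - z)"
    have on: "cmod (circlepath z r t - z) = r" for t
      using r by (simp add: circlepath norm_mult)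
    then have dist: "dist (circlepath z r t) z < d" for t
      using r by (simp add: dist_norm)
    have "homotopic_loops (- {\<Phi> z}) ?g (\<Phi> \<circ> circlepath z r)"
    proof (rule homotopic_loops_nearby_explicit)
      show "path ?g" unfolding path_def circlepath by (intro continuous_intros)
      have "path_image (circlepath z r) \<subseteq> S" using d(2) dist by (auto simp: path_image_def)
      then show "path (\<Phi> \<circ> circlepath z r)"
        by (intro path_continuous_image continuous_on_subset[OF assms(3)]) auto
      show "pathfinish ?g = pathstart ?g"
        by (simp add: pathfinish_def pathstart_def circlepath)
      show "pathfinish (\<Phi> \<circ> circlepath z r) = pathstart (\<Phi> \<circ> circlepath z r)"
        by (simp add: pathfinish_compose pathstart_compose)
      fix t :: real and x assume "x \<notin> - {\<Phi> z}"
      then have "x = \<Phi> z" by simp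
      have "norm ((\<Phi> \<circ> circlepath z r) t - ?g t) \<le> q * cmod A * r"
        using d(2)[OF dist] on by (simp add: algebra_simps)
      also have "\<dots> < 1 * cmod A * r"
        using A r by (intro mult_strict_right_mono) auto
      finally show "norm ((\<Phi> \<circ> circlepath z r) t - ?g t) < norm (?g t - x)"
        using on by (simp add: \<open>x = \<Phi> z\<close> norm_mult)
    qed
    from winding_number_homotopic_loops[OF this] show ?thesis
      using winding_number_linear_image_circle[OF A(1) r(1)] by simp
  qed
  have "\<forall>\<^sub>F r in at_right 0. r \<in> {0<..<d}" 
    using d(1) by (rule eventually_at_right_real)
  then show ?thesis by eventually_elim (use main in auto)
qed

section \<open>Homeomorphisms of the sphere\<close>

lemma topspace_sphere_topology [simp]: "topspace sphere_topology = UNIV"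
  unfolding sphere_topology_def by (auto simp: notin_range_Some)

text \<open>By Heine-Borel the complements of neighbourhoods of infinity are the closed bounded
  sets; continuity on the sphere thus becomes a question about subsets of the plane.\<close>

lemma openin_sphere_topology:
  "openin sphere_topology V \<longleftrightarrow>
     open (Some -` V) \<and> (None \<in> V \<longrightarrow> bounded (- (Some -` V)))"
proof -
  have eq: "V = (if None \<in> V then insert None (Some ` (Some -` V)) else Some ` (Some -` V))"
    by (auto simp: image_iff) (metis not_None_eq)+
  have "(\<exists>C. compact C \<and> closed C \<and> V = insert None (Some ` (- C))) \<longleftrightarrow>
     None \<in> V \<and> open (Some -` V) \<and> bounded (- (Some -` V))" (is "?l \<longleftrightarrow> ?r")
  proof
    assume ?l
    then obtain C where C: "compact C" "V = insert None (Some ` (- C))" by auto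
    then have "Some -` V = - C" by auto
    then show ?r using C compact_imp_closed compact_imp_bounded by auto
  next
    assume ?r
    then show ?l using eq
      by (intro exI[of _ "- (Some -` V)"]) (auto simp: compact_eq_bounded_closed closed_def)
  qed
  moreover have "(\<exists>U. open U \<and> V = Some ` U) \<longleftrightarrow> None \<notin> V \<and> open (Some -` V)"
    using eq by (auto simp: inj_vimage_image_eq)
  ultimately show ?thesis
    unfolding sphere_topology_def openin_Alexandroff_compactification
    by (auto simp: Compl_eq_Diff_UNIV)
qed

text \<open>A continuous map from a compact space to a Hausdorff space is closed, so bijectivity
  makes the inverse continuous.\<close>

lemma homeomorphic_map_sphereI:
  assumes "bij G" and "\<And>V. openin sphere_topology V \<Longrightarrow> openin sphere_topology (G -` V)"
  shows "homeomorphic_map sphere_topology sphere_topology G"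
proof (rule continuous_imp_homeomorphic_map)
  show "continuous_map sphere_topology sphere_topology G"
    using assms(2) by (auto simp: continuous_map_def vimage_def)
  show "compact_space sphere_topology" by (simp add: sphere_topology_def)
  show "Hausdorff_space sphere_topology"
    unfolding sphere_topology_def Hausdorff_space_Alexandroff_compactification
    by (simp add: locally_compact_space_euclidean)
  show "G ` topspace sphere_topology = topspace sphere_topology" "inj_on G (topspace sphere_topology)"
    using assms(1) by (auto simp: bij_def)
qed

lemma sphere_inversion_simps [simp]:
  "sphere_inversion None = Some 0"
  "sphere_inversion (Some z) = (if z = 0 then None else Some (1 / z))"
  by (auto simp: sphere_inversion_def sphere_quotient_def)

lemma sphere_inversion_involution [simp]: "sphere_inversion (sphere_inversion p) = p"
  by (cases p) auto

lemma homeomorphic_map_sphere_inversion: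
  "homeomorphic_map sphere_topology sphere_topology sphere_inversion"
proof (rule homeomorphic_map_sphereI)
  show "bij sphere_inversion"
    by (rule involuntory_imp_bij) simp
  fix V assume "openin sphere_topology V"
  define W where "W = Some -` V"
  have W: "open W" "None \<in> V \<Longrightarrow> bounded (- W)"
    using \<open>openin sphere_topology V\<close> by (auto simp: openin_sphere_topology W_def)
  define Z where "Z = {z \<in> - {0}. 1 / z \<in> W}"
  have "open (- {0} \<inter> (\<lambda>z. 1 / z) -` W)"
    using W(1) by (intro continuous_open_preimage continuous_intros) auto
  then have Z: "open Z" by (simp add: Z_def vimage_def Int_def)
  have eq: "Some -` (sphere_inversion -` V) = Z \<union> (if None \<in> V then {0} else {})"
    by (auto simp: Z_def W_def split: if_splits)
  have "open (Some -` (sphere_inversion -` V))"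
  proof (cases "None \<in> V")
    case True
    then obtain B where B: "B > 0" "\<And>w. w \<notin> W \<Longrightarrow> cmod w \<le> B"
      using W(2) unfolding bounded_pos by auto
    \<comment> \<open>\<open>B\<close> bounds the complement of \<open>W\<close>, so
      \<open>1 / z\<close> lies in \<open>W\<close> once \<open>0 < cmod z < 1 / B\<close>; adding
      the origin therefore leaves the set open.\<close>
    have "Z \<union> {0} = Z \<union> ball 0 (1 / B)"
    proof -
      have "z \<in> Z" if "z \<noteq> 0" "cmod z < 1 / B" for z
      proof -
        have "B < cmod (1 / z)" using that B by (simp add: norm_divide field_simps)
        then show ?thesis using B(2)[of "1 / z"] that by (force simp: Z_def)
      qed
      then have "x \<in> Z \<union> {0}" if "x \<in> ball 0 (1 / B)" for x
        using that by (cases "x = 0") auto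
      moreover have "0 \<in> ball 0 (1 / B)" using B(1) by simp
      ultimately show ?thesis by blast
    qed
    then have "open (Z \<union> {0})" using Z by (metis open_Un open_ball)
    then show ?thesis using eq True by simp
  qed (use eq Z in simp)
  moreover have "bounded (- (Some -` (sphere_inversion -` V)))" if "None \<in> sphere_inversion -` V"
  proof -
    have "0 \<in> W" using that by (simp add: W_def)
    then obtain d where d: "d > 0" "ball 0 d \<subseteq> W" using W(1) open_contains_ball by blast
    have "cmod z \<le> 1 / d" if "z \<notin> Z" for z
    proof (rule ccontr)
      assume "\<not> cmod z \<le> 1 / d"
      then have "cmod z > 1 / d" by simp
      moreover have "0 < 1 / d" using d by simp
      ultimately have "0 < cmod z" by linarith
      with \<open>cmod z > 1 / d\<close> have "z \<noteq> 0" "cmod (1 / z) < d" using d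
        by (auto simp: norm_divide field_simps)
      then show False using d(2) that by (auto simp: Z_def)
    qed
    then show ?thesis unfolding eq bounded_iff by auto
  qed
  ultimately show "openin sphere_topology (sphere_inversion -` V)"
    by (simp add: openin_sphere_topology)
qed

text \<open>One criterion for all four charts. The Beltrami inequality is asked off
  \<open>N\<close>, but near linearity on all of \<open>\<Omega>\<close>, because the index
  condition admits no exceptional points. Since \<open>finite_part\<close> is unspecified where the
  value is infinity, \<open>f\<close> is compared with it on \<open>\<Omega>\<close> only.\<close>

lemma quasiconformal_chartI:
  fixes \<Psi> :: "riemann_sphere \<Rightarrow> riemann_sphere"
  assumes val: "\<And>z. \<Psi> (Some z) = (if z \<in> \<Omega> then Some (f z) else None)"
    and "open \<Omega>" and lip: "lipschitz_on_compacts \<Omega> f"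
    and "closed N" "negligible N"
    and bel: "\<And>z. z \<in> \<Omega> - N \<Longrightarrow> beltrami_at k f z"
    and lin: "\<And>z. z \<in> \<Omega> \<Longrightarrow> nearly_linear f z"
  shows "(\<forall>z\<in>finite_domain \<Psi>. \<forall>\<^sub>F r in at_right 0.
      winding_number (finite_part \<Psi> \<circ> circlepath z r) (finite_part \<Psi> z) = 1) \<and>
    (\<exists>f\<^sub>x f\<^sub>y. W12_loc (finite_domain \<Psi>) (finite_part \<Psi>) f\<^sub>x f\<^sub>y \<and>
      (AE z in lebesgue. z \<in> finite_domain \<Psi> \<longrightarrow>
         cmod ((f\<^sub>x z + \<i> * f\<^sub>y z) / 2) \<le> k * cmod ((f\<^sub>x z - \<i> * f\<^sub>y z) / 2)))"
proof -
  let ?f = "finite_part \<Psi>"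
  have dom: "finite_domain \<Psi> = \<Omega>" using val by (auto simp: finite_domain_def)
  have part: "?f z = f z" if "z \<in> \<Omega>" for z using val that by (simp add: finite_part_def)
  have lip': "lipschitz_on_compacts \<Omega> ?f"
    using lipschitz_on_compacts_transform[OF lip] part by blast
  show ?thesis
    unfolding dom
  proof (intro conjI ballI)
    fix z assume z: "z \<in> \<Omega>"
    have "nearly_linear ?f z"
      using nearly_linear_transform[OF lin[OF z] \<open>open \<Omega>\<close> z] part by blast
    then show "\<forall>\<^sub>F r in at_right 0. winding_number (?f \<circ> circlepath z r) (?f z) = 1"
      using nearly_linear_winding_number[OF \<open>open \<Omega>\<close> z
          lipschitz_on_compacts_continuous_on[OF \<open>open \<Omega>\<close> lip']] by blast
  next
    have "beltrami_at k ?f z" if "z \<in> \<Omega> - N" for z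
      using beltrami_at_transform[OF bel[OF that] \<open>open \<Omega>\<close>] that part by simp
    then show "\<exists>f\<^sub>x f\<^sub>y. W12_loc \<Omega> ?f f\<^sub>x f\<^sub>y \<and> (AE z in lebesgue. z \<in> \<Omega> \<longrightarrow>
         cmod ((f\<^sub>x z + \<i> * f\<^sub>y z) / 2) \<le> k * cmod ((f\<^sub>x z - \<i> * f\<^sub>y z) / 2))"
      using beltrami_W12_loc[OF \<open>open \<Omega>\<close> \<open>closed N\<close> \<open>negligible N\<close> lip']
      unfolding beltrami_at_def by blast
  qed
qed

lemma has_field_derivative_one_divide:
  fixes z :: complex
  assumes "z \<noteq> 0"
  shows "((\<lambda>z. 1 / z) has_field_derivative - (1 / z\<^sup>2)) (at z)"
  using assms by (auto intro!: derivative_eq_intros simp: power2_eq_square)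

section \<open>Perturbations of the identity\<close>

text \<open>\<open>near\<close> says that \<open>F\<close> minus the identity is a contraction;
  \<open>bounded\<close> is the control at infinity that makes \<open>1 / F (1 / z)\<close> tangent
  to the identity at the origin.\<close>

locale near_identity =
  fixes k B :: real and F :: "complex \<Rightarrow> complex"
  assumes k: "0 \<le> k" "k < 1" and F0: "F 0 = 0"
    and near: "\<And>z w. cmod (F z - F w - (z - w)) \<le> k * cmod (z - w)"
    and bounded: "\<And>z. cmod (F z - z) \<le> B"
    and beltrami: "\<And>z. cmod z \<noteq> 1 \<Longrightarrow> beltrami_at k F z"
begin

lemma upper: "cmod (F z - F w) \<le> (1 + k) * cmod (z - w)"
proof -
  have "cmod (F z - F w) \<le> cmod (F z - F w - (z - w)) + cmod (z - w)"
    using norm_triangle_ineq[of "F z - F w - (z - w)" "z - w"] by simp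
  then show ?thesis using near[of z w] by (simp add: algebra_simps)
qed

lemma lower: "(1 - k) * cmod (z - w) \<le> cmod (F z - F w)"
proof -
  have "cmod (z - w) \<le> cmod (F z - F w) + cmod (F z - F w - (z - w))"
    using norm_triangle_ineq4[of "F z - F w" "F z - F w - (z - w)"] by simp
  then show ?thesis using near[of z w] by (simp add: left_diff_distrib)
qed

lemma norm_lower: "(1 - k) * cmod z \<le> cmod (F z)"
  using lower[of z 0] by (simp add: F0)

lemma eq_0_iff [simp]: "F z = 0 \<longleftrightarrow> z = 0"
  using norm_lower[of z] k F0 by (auto simp: mult_le_0_iff)

lemma lipschitz: "(1 + k)-lipschitz_on S F"
  using upper k by (intro lipschitz_onI) (auto simp: dist_norm)

lemma isCont_F: "isCont F z"
  using lipschitz_on_continuous_on[OF lipschitz[of UNIV]] by (simp add: continuous_on_eq_continuous_at)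

lemma bij_F: "bij F"
proof (rule bijI)
  show "inj F"
  proof (rule injI)
    fix z w assume "F z = F w"
    then show "z = w" using lower[of z w] k by (simp add: mult_le_0_iff)
  qed
  have "\<exists>z. w = F z" for w
  proof -
    \<comment> \<open>A fixed point of this map is exactly a solution of \<open>F z = w\<close>, and
      \<open>near\<close> makes it a contraction.\<close>
    let ?T = "\<lambda>z. w - (F z - z)"
    have "dist (?T x) (?T y) \<le> k * dist x y" for x y
    proof -
      have "dist (?T x) (?T y) = cmod (F x - F y - (x - y))"
        unfolding dist_norm by (subst norm_minus_commute) (simp add: algebra_simps)
      then show ?thesis using near[of x y] by (simp add: dist_norm)
    qed
    then have "\<exists>!z. ?T z = z" using banach_fix_type[OF k, of ?T] by blast
    then obtain z where "w - (F z - z) = z" by blast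
    then have "w = F z" by (simp add: algebra_simps)
    then show ?thesis ..
  qed
  then show "surj F" by (simp add: surj_def)
qed

text \<open>\<open>A = 1\<close> and \<open>q = k\<close> work at every point, so the unit circle,
  where \<open>F\<close> need not be differentiable, is no exception.\<close>

lemma nearly_linear_F: "nearly_linear F z"
  unfolding nearly_linear_def using near k by (intro exI[of _ 1] exI[of _ k]) auto

definition G :: "riemann_sphere \<Rightarrow> riemann_sphere" where
  "G = sphere_inversion \<circ> map_option F \<circ> sphere_inversion"

lemma homeomorphic_map_option:
  "homeomorphic_map sphere_topology sphere_topology (map_option F)"
proof (rule homeomorphic_map_sphereI)
  show "bij (map_option F)"
  proof (rule bijI)
    show "inj (map_option F)" using bij_F by (simp add: option.inj_map bij_def)
    have "\<exists>y. x = map_option F y" for x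
    proof (cases x)
      case None
      then show ?thesis by (intro exI[of _ None]) simp
    next
      case (Some w)
      obtain z where "w = F z" using bij_F by (metis bij_def surjD)
      with Some show ?thesis by (intro exI[of _ "Some z"]) simp
    qed
    then show "surj (map_option F)" by (simp add: surj_def)
  qed
  fix V assume "openin sphere_topology V"
  then have V: "open (Some -` V)" "None \<in> V \<Longrightarrow> bounded (- (Some -` V))"
    by (auto simp: openin_sphere_topology)
  have eq: "Some -` (map_option F -` V) = F -` (Some -` V)" by auto
  have "open (F -` (Some -` V))"
    using V(1) by (intro open_vimage lipschitz_on_continuous_on[OF lipschitz])
  moreover have "bounded (- (F -` (Some -` V)))" if None: "None \<in> V"
  proof -
    obtain M where M: "\<And>w. w \<notin> Some -` V \<Longrightarrow> cmod w \<le> M"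
      using V(2)[OF None] unfolding bounded_iff by auto
    \<comment> \<open>The lower bound on \<open>cmod (F z)\<close> makes \<open>F\<close> proper,
      which is continuity at infinity.\<close>
    have "cmod z \<le> M / (1 - k)" if "F z \<notin> Some -` V" for z
      using M[OF that] norm_lower[of z] k by (simp add: pos_le_divide_eq mult.commute)
    then show ?thesis unfolding bounded_iff by auto
  qed
  ultimately show "openin sphere_topology (map_option F -` V)"
    unfolding openin_sphere_topology eq by simp
qed

lemma homeomorphic_map_G: "homeomorphic_map sphere_topology sphere_topology G"
  unfolding G_def
  by (intro homeomorphic_map_compose[of _ sphere_topology]
      homeomorphic_map_option homeomorphic_map_sphere_inversion)

lemma image_norm_ge: "F ` {z. \<delta> \<le> cmod z} \<subseteq> {z. (1 - k) * \<delta> \<le> cmod z}"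
proof clarify
  fix z assume "\<delta> \<le> cmod z"
  then have "(1 - k) * \<delta> \<le> (1 - k) * cmod z" using k by (intro mult_left_mono) auto
  then show "(1 - k) * \<delta> \<le> cmod (F z)" using norm_lower[of z] by linarith
qed

lemma nearly_linear_inverse_F:
  assumes "z \<noteq> 0" shows "nearly_linear (\<lambda>w. 1 / F w) z"
  using assms by (intro nearly_linear_compose_left[OF nearly_linear_F has_field_derivative_one_divide] isCont_F) auto

lemma nearly_linear_F_inverse:
  assumes "z \<noteq> 0" shows "nearly_linear (\<lambda>w. F (1 / w)) z"
  using assms by (intro nearly_linear_compose_right[OF nearly_linear_F has_field_derivative_one_divide]) auto

text \<open>Away from \<open>0\<close> this is a composition. At \<open>0\<close>,
  \<open>near\<close> alone yields the relative error \<open>k / (1 - k)\<close>, which may exceed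
  \<open>1\<close>; the bound \<open>B\<close> improves it to
  \<open>B * cmod w / (1 - k)\<close>.\<close>

lemma nearly_linear_inverse_F_inverse: "nearly_linear (\<lambda>w. 1 / F (1 / w)) z"
proof (cases "z = 0")
  case False
  then show ?thesis
    by (intro nearly_linear_compose_right[OF nearly_linear_inverse_F has_field_derivative_one_divide]) auto
next
  case True
  have B: "0 \<le> B" using bounded[of 0] norm_ge_zero order_trans by blast
  \<comment> \<open>Within this radius the relative error is at most \<open>1 / 2\<close>;
    \<open>B + 1\<close> keeps the denominator positive if \<open>B = 0\<close>.\<close>
  define d where "d = (1 - k) / (2 * (B + 1))"
  have d: "0 < d" "B * d \<le> (1 - k) / 2"
    using k B by (auto simp: d_def field_simps)
  have "cmod (1 / F (1 / w) - w) \<le> 1 / 2 * cmod w" if w: "cmod w < d" for w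
  proof (cases "w = 0")
    case False
    have "1 / F (1 / w) - w = - (w * (F (1 / w) - 1 / w) / F (1 / w))"
      using False by (simp add: field_simps)
    then have eq: "cmod (1 / F (1 / w) - w) = cmod w * (cmod (F (1 / w) - 1 / w) / cmod (F (1 / w)))"
      by (simp add: norm_mult norm_divide)
    have l: "(1 - k) / cmod w \<le> cmod (F (1 / w))"
      using norm_lower[of "1 / w"] by (simp add: norm_divide)
    have "cmod (F (1 / w) - 1 / w) / cmod (F (1 / w)) \<le> B / ((1 - k) / cmod w)"
      using l B k False bounded by (intro frac_le) auto
    also have "\<dots> = B * cmod w / (1 - k)" by simp
    also have "\<dots> \<le> B * d / (1 - k)" using w B k by (intro divide_right_mono mult_left_mono) auto
    also have "\<dots> \<le> 1 / 2" using d k by (simp add: field_simps)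
    finally have "cmod w * (cmod (F (1 / w) - 1 / w) / cmod (F (1 / w))) \<le> cmod w * (1 / 2)"
      by (rule mult_left_mono) simp
    then show ?thesis unfolding eq by simp
  qed (simp add: F0)
  then have "\<forall>\<^sub>F w in nhds 0. cmod (1 / F (1 / w) - 1 / F (1 / 0) - 1 * (w - 0)) \<le> 1 / 2 * cmod 1 * cmod (w - 0)"
    unfolding eventually_nhds_metric using d by (intro exI[of _ d]) (auto simp: F0)
  then show ?thesis
    unfolding nearly_linear_def True by (intro exI[of _ 1] exI[of _ "1 / 2"]) auto
qed

text \<open>The upper bound for the difference of the values of \<open>F\<close> and the lower
  bounds for the two denominators both carry \<open>1 / (cmod z * cmod w)\<close>, which cancels.
  The origin is treated separately: there \<open>1 / 0 = 0\<close> gives the value \<open>0\<close>,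
  which is also the value of \<open>G\<close>.\<close>

lemma lipschitz_inverse_F_inverse:
  "((1 + k) / (1 - k)\<^sup>2)-lipschitz_on S (\<lambda>w. 1 / F (1 / w))"
proof (rule lipschitz_onI)
  let ?g = "\<lambda>w. 1 / F (1 / w)"
  have small: "cmod (?g z) \<le> (1 + k) / (1 - k)\<^sup>2 * cmod z" for z
  proof (cases "z = 0")
    case False
    have "(1 - k) / cmod z \<le> cmod (F (1 / z))"
      using norm_lower[of "1 / z"] by (simp add: norm_divide)
    then have "cmod (?g z) \<le> 1 / ((1 - k) / cmod z)"
      using False k unfolding norm_divide by (intro frac_le) auto
    also have "\<dots> = 1 / (1 - k) * cmod z" by simp
    also have "\<dots> \<le> (1 + k) / (1 - k)\<^sup>2 * cmod z"
    proof (rule mult_right_mono)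
      have "1 / (1 - k) = (1 - k) / (1 - k)\<^sup>2" using k by (simp add: power2_eq_square)
      also have "\<dots> \<le> (1 + k) / (1 - k)\<^sup>2" using k by (intro divide_right_mono) auto
      finally show "1 / (1 - k) \<le> (1 + k) / (1 - k)\<^sup>2" .
    qed simp
    finally show ?thesis .
  qed (simp add: F0)
  fix z w
  show "dist (?g z) (?g w) \<le> (1 + k) / (1 - k)\<^sup>2 * dist z w"
  proof (cases "z = 0 \<or> w = 0")
    case True
    then show ?thesis using small[of z] small[of w] by (auto simp: dist_norm F0)
  next
    case False
    have low: "(1 - k) / cmod z \<le> cmod (F (1 / z))" "(1 - k) / cmod w \<le> cmod (F (1 / w))"
      using norm_lower[of "1 / z"] norm_lower[of "1 / w"] by (simp_all add: norm_divide)
    have "?g z - ?g w = (F (1 / w) - F (1 / z)) / (F (1 / z) * F (1 / w))"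
      using False by (simp add: diff_frac_eq)
    then have "dist (?g z) (?g w) = cmod (F (1 / w) - F (1 / z)) / (cmod (F (1 / z)) * cmod (F (1 / w)))"
      by (simp add: dist_norm norm_divide norm_mult)
    also have "\<dots> \<le> ((1 + k) * cmod (1 / w - 1 / z)) / ((1 - k) / cmod z * ((1 - k) / cmod w))"
      using False k low by (intro frac_le upper mult_mono) (auto intro!: mult_pos_pos divide_pos_pos)
    also have "cmod (1 / w - 1 / z) = cmod (z - w) / (cmod z * cmod w)"
      using False by (simp add: diff_frac_eq norm_divide norm_mult mult.commute)
    also have "((1 + k) * (cmod (z - w) / (cmod z * cmod w))) / ((1 - k) / cmod z * ((1 - k) / cmod w))
        = (1 + k) / (1 - k)\<^sup>2 * dist z w"
      using False by (simp add: dist_norm power2_eq_square)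
    finally show ?thesis .
  qed
qed (use k in auto)

lemma beltrami_inverse_F:
  assumes "z \<noteq> 0" "cmod z \<noteq> 1" shows "beltrami_at k (\<lambda>w. 1 / F w) z"
  using assms by (intro beltrami_at_compose_left[OF beltrami has_field_derivative_one_divide]) auto

lemma beltrami_F_inverse:
  assumes "z \<noteq> 0" "cmod z \<noteq> 1" shows "beltrami_at k (\<lambda>w. F (1 / w)) z"
  using assms
  by (intro beltrami_at_compose_right[OF beltrami has_field_derivative_one_divide]) (auto simp: norm_divide)

lemma beltrami_inverse_F_inverse:
  assumes "z \<noteq> 0" "cmod z \<noteq> 1" shows "beltrami_at k (\<lambda>w. 1 / F (1 / w)) z"
  using assms
  by (intro beltrami_at_compose_right[OF beltrami_inverse_F has_field_derivative_one_divide]) (auto simp: norm_divide)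

text \<open>The inversion is an involution, so a change of chart cancels the inversion at that end
  of \<open>G\<close>.\<close>

lemma chart_representations_G:
  "chart_representations G = {G, sphere_inversion \<circ> map_option F,
     map_option F \<circ> sphere_inversion, map_option F}"
proof -
  have [simp]: "sphere_inversion \<circ> (sphere_inversion \<circ> f) = f" for f :: "riemann_sphere \<Rightarrow> riemann_sphere"
    by auto
  have [simp]: "f \<circ> sphere_inversion \<circ> sphere_inversion = f" for f :: "riemann_sphere \<Rightarrow> riemann_sphere"
    by auto
  have "chart_representations G =
      (\<Union>s\<in>{id, sphere_inversion}. \<Union>t\<in>{id, sphere_inversion}. {t \<circ> G \<circ> s})"
    unfolding chart_representations_def by blast
  also have "\<dots> = {G, G \<circ> sphere_inversion, sphere_inversion \<circ> G,
      sphere_inversion \<circ> G \<circ> sphere_inversion}"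
    by auto
  also have "\<dots> = {G, sphere_inversion \<circ> map_option F,
     map_option F \<circ> sphere_inversion, map_option F}"
    by (auto simp: G_def o_assoc[symmetric])
  finally show ?thesis .
qed

lemma quasiconformal_G: "quasiconformal k G"
proof -
  \<comment> \<open>The origin joins the circle because the Beltrami inequality for
    \<open>1 / F (1 / w)\<close> is established only away from it.\<close>
  let ?N = "insert 0 (sphere (0::complex) 1)"
  have N: "closed ?N" "negligible ?N" by (auto simp: negligible_sphere)
  have "(\<forall>z\<in>finite_domain \<Psi>. \<forall>\<^sub>F r in at_right 0.
      winding_number (finite_part \<Psi> \<circ> circlepath z r) (finite_part \<Psi> z) = 1) \<and>
    (\<exists>f\<^sub>x f\<^sub>y. W12_loc (finite_domain \<Psi>) (finite_part \<Psi>) f\<^sub>x f\<^sub>y \<and>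
      (AE z in lebesgue. z \<in> finite_domain \<Psi> \<longrightarrow>
         cmod ((f\<^sub>x z + \<i> * f\<^sub>y z) / 2) \<le> k * cmod ((f\<^sub>x z - \<i> * f\<^sub>y z) / 2)))"
    if "\<Psi> \<in> chart_representations G" for \<Psi>
  proof -
    consider "\<Psi> = G" | "\<Psi> = sphere_inversion \<circ> map_option F"
      | "\<Psi> = map_option F \<circ> sphere_inversion" | "\<Psi> = map_option F"
      using \<open>\<Psi> \<in> _\<close> unfolding chart_representations_G by blast
    then show ?thesis
    proof cases
      case 1
      show ?thesis
      proof (rule quasiconformal_chartI[where \<Omega> = UNIV and f = "\<lambda>w. 1 / F (1 / w)", OF _ _ _ N])
        show "lipschitz_on_compacts UNIV (\<lambda>w. 1 / F (1 / w))"
          unfolding lipschitz_on_compacts_def using lipschitz_inverse_F_inverse by blast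
      qed (use 1 in \<open>auto simp: G_def F0 beltrami_inverse_F_inverse nearly_linear_inverse_F_inverse\<close>)
    next
      case 2
      show ?thesis
      proof (rule quasiconformal_chartI[where \<Omega> = "- {0}" and f = "\<lambda>w. 1 / F w", OF _ _ _ N])
        show "lipschitz_on_compacts (- {0}) (\<lambda>w. 1 / F w)"
        proof (rule lipschitz_on_compactsI)
          fix \<delta> :: real assume "0 < \<delta>"
          \<comment> \<open>\<open>F\<close> sends the points of modulus at least
            \<open>\<delta>\<close> to points of modulus at least \<open>(1 - k) * \<delta>\<close>,
            where the inversion is Lipschitz.\<close>
          then have "0 < (1 - k) * \<delta>" using k by simp
          from lipschitz_on_compose2[OF lipschitz
              lipschitz_on_subset[OF lipschitz_on_inverse_norm_ge[OF this] image_norm_ge]]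
          show "\<exists>L. L-lipschitz_on {z. \<delta> \<le> cmod z} (\<lambda>w. 1 / F w)" by blast
        qed
      qed (use 2 in \<open>auto simp: beltrami_inverse_F nearly_linear_inverse_F\<close>)
    next
      case 3
      show ?thesis
      proof (rule quasiconformal_chartI[where \<Omega> = "- {0}" and f = "\<lambda>w. F (1 / w)", OF _ _ _ N])
        show "lipschitz_on_compacts (- {0}) (\<lambda>w. F (1 / w))"
        proof (rule lipschitz_on_compactsI)
          fix \<delta> :: real assume "0 < \<delta>"
          from lipschitz_on_compose2[OF lipschitz_on_inverse_norm_ge[OF this] lipschitz]
          show "\<exists>L. L-lipschitz_on {z. \<delta> \<le> cmod z} (\<lambda>w. F (1 / w))" by blast
        qed
      qed (use 3 in \<open>auto simp: beltrami_F_inverse nearly_linear_F_inverse\<close>)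
    next
      case 4
      show ?thesis
      proof (rule quasiconformal_chartI[where \<Omega> = UNIV and f = F, OF _ _ _ N])
        show "lipschitz_on_compacts UNIV F"
          unfolding lipschitz_on_compacts_def using lipschitz by blast
      qed (use 4 in \<open>auto simp: beltrami nearly_linear_F\<close>)
    qed
  qed
  then show ?thesis
    unfolding quasiconformal_def sense_preserving_def using homeomorphic_map_G k by blast
qed

end

section \<open>The extension\<close>

definition fold_disk :: "complex \<Rightarrow> complex" where
  "fold_disk z = (if cmod z \<le> 1 then z else 1 / cnj z)"

lemma norm_fold_disk_le: "cmod (fold_disk z) \<le> 1"
  by (auto simp: fold_disk_def norm_divide divide_le_eq)

text \<open>For two exterior points the distance is divided by \<open>cmod z * cmod w > 1\<close>.
  The mixed case says that reflecting an exterior point in the circle brings it no farther from any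
  point of the closed disk.\<close>

lemma norm_fold_disk_diff_le: "cmod (fold_disk z - fold_disk w) \<le> cmod (z - w)"
proof -
  have out: "cmod (1 / cnj z - 1 / cnj w) \<le> cmod (z - w)" if "1 < cmod z" "1 < cmod w" for z w
  proof -
    have "z \<noteq> 0" "w \<noteq> 0" using that by auto
    then have "cmod (1 / cnj z - 1 / cnj w) = cmod (cnj (w - z)) / (cmod z * cmod w)"
      by (simp add: diff_frac_eq norm_divide norm_mult)
    also have "\<dots> \<le> cmod (cnj (w - z)) / 1"
      using less_1_mult[OF that] by (intro divide_left_mono) auto
    finally show ?thesis by (simp only: complex_mod_cnj div_by_1 norm_minus_commute)
  qed
  have mixed: "cmod (z - 1 / cnj w) \<le> cmod (z - w)" if "cmod z \<le> 1" "1 < cmod w" for z w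
  proof -
    have "w \<noteq> 0" using that by auto
    \<comment> \<open>Expanding both squares gives this factorization; since
      \<open>Re (z * cnj w) \<le> cmod w\<close>, the last factor is at most
      \<open>- (cmod w - 1)^2\<close>.\<close>
    have "(cmod (z * cnj w - 1))\<^sup>2 - (cmod w * cmod (z - w))\<^sup>2
        = ((cmod w)\<^sup>2 - 1) * (2 * Re (z * cnj w) - (cmod w)\<^sup>2 - 1)"
      unfolding power_mult_distrib cmod_power2 by (simp add: power2_eq_square algebra_simps)
    also have "\<dots> \<le> 0"
    proof (rule mult_nonneg_nonpos)
      show "0 \<le> (cmod w)\<^sup>2 - 1" using that by (simp add: abs_square_le_1 one_le_power)
      have "Re (z * cnj w) \<le> cmod z * cmod w"
        by (metis complex_Re_le_cmod complex_mod_cnj norm_mult)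
      also have "\<dots> \<le> 1 * cmod w" using that by (intro mult_right_mono) auto
      finally show "2 * Re (z * cnj w) - (cmod w)\<^sup>2 - 1 \<le> 0"
        using zero_le_power2[of "cmod w - 1"] by (simp add: power2_diff)
    qed
    finally have "cmod (z * cnj w - 1) \<le> cmod w * cmod (z - w)"
      using power2_le_imp_le[of "cmod (z * cnj w - 1)" "cmod w * cmod (z - w)"] by simp
    moreover have "z - 1 / cnj w = (z * cnj w - 1) / cnj w"
      using \<open>w \<noteq> 0\<close> by (simp add: field_simps)
    ultimately show ?thesis
      using \<open>w \<noteq> 0\<close> by (simp add: norm_divide divide_le_eq mult.commute)
  qed
  consider "cmod z \<le> 1" "cmod w \<le> 1" | "cmod z \<le> 1" "1 < cmod w" | "1 < cmod z" "cmod w \<le> 1"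
    | "1 < cmod z" "1 < cmod w" by linarith
  then show ?thesis
  proof cases
    case 3
    then show ?thesis using mixed[of w z] by (simp add: fold_disk_def norm_minus_commute)
  qed (use out mixed in \<open>auto simp: fold_disk_def\<close>)
qed

section \<open>Passage from the exterior to the unit disk\<close>

text \<open>The Laurent tail of \<open>g\<close> becomes a power series \<open>P\<close> with
  \<open>z * g (1 / z) = 1 + z * P z\<close>. Writing \<open>f\<close> as
  \<open>z / (1 + z * P z)\<close> makes it visibly differentiable at \<open>0\<close>.\<close>

lemma class_M_inverted:
  assumes g: "g \<in> class_M" and U: "\<And>\<zeta>. \<zeta> \<in> exterior_disk \<Longrightarrow> cmod (U g \<zeta>) \<le> k" and k: "0 < k" "k < 1"
  obtains f f' where "\<And>z. cmod z < 1 \<Longrightarrow> (f has_field_derivative f' z) (at z)"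
    "\<And>z. cmod z < 1 \<Longrightarrow> cmod (f' z - 1) \<le> k" "f 0 = 0"
    "\<And>z. 0 < cmod z \<Longrightarrow> cmod z < 1 \<Longrightarrow> f z = 1 / g (1 / z) \<and> g (1 / z) \<noteq> 0"
proof -
  have ext: "1 / z \<in> exterior_disk" if "0 < cmod z" "cmod z < 1" for z
    using that by (simp add: exterior_disk_def norm_divide)
  have "open exterior_disk"
    unfolding exterior_disk_def by (intro open_Collect_less continuous_intros)
  obtain b where b: "\<And>\<zeta>. \<zeta> \<in> exterior_disk \<Longrightarrow> (\<lambda>n. b n / \<zeta> ^ n) sums (g \<zeta> - \<zeta>)"
    and hol: "g holomorphic_on exterior_disk"
    using g unfolding class_M_def by blast
  \<comment> \<open>\<open>b 0\<close> is the sum of the series at the origin, where division by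
    zero would produce \<open>g 0\<close> instead.\<close>
  define P where "P z = (if z = 0 then b 0 else g (1 / z) - 1 / z)" for z
  have "(\<lambda>n. b n * (z - 0) ^ n) sums P z" if "z \<in> ball 0 1" for z
  proof (cases "z = 0")
    case True
    then show ?thesis using powser_sums_zero[of b] by (simp add: P_def)
  next
    case False
    then show ?thesis using b[OF ext[of z]] that by (simp add: P_def power_one_over field_simps)
  qed
  then have P: "P holomorphic_on ball 0 1" by (rule power_series_holomorphic)
  have gnz: "g \<zeta> \<noteq> 0" if "\<zeta> \<in> exterior_disk" for \<zeta>
    using U[OF that] k by (auto simp: U_def)
  have g_P: "z * g (1 / z) = 1 + z * P z" if "z \<noteq> 0" for z
    using that by (simp add: P_def field_simps)
  have nz: "1 + z * P z \<noteq> 0" if "cmod z < 1" for z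
    using gnz[OF ext[of z]] g_P[of z] that by (cases "z = 0") auto
  define f where "f z = z / (1 + z * P z)" for z
  \<comment> \<open>The chain rule gives \<open>deriv g (1 / z) / (z * g (1 / z))^2\<close>, that is
    \<open>1 + U g (1 / z)\<close>; the value \<open>1\<close> at the origin reflects the leading
    term of \<open>g\<close>.\<close>
  define f' where "f' z = (if z = 0 then 1 else 1 + U g (1 / z))" for z
  have f_g: "f z = 1 / g (1 / z)" if "0 < cmod z" "cmod z < 1" for z
    using that g_P[of z] by (simp add: f_def g_P[symmetric])
  show thesis
  proof
    fix z :: complex assume z: "cmod z < 1"
    show "(f has_field_derivative f' z) (at z)"
    proof (cases "z = 0")
      case True
      have "(P has_field_derivative deriv P 0) (at 0)"
        using holomorphic_derivI[OF P] by simp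
      then show ?thesis
        unfolding True f_def f'_def by (auto intro!: derivative_eq_intros)
    next
      case False
      then have "1 / z \<in> exterior_disk" using ext z by simp
      then have dg: "(g has_field_derivative deriv g (1 / z)) (at (1 / z))"
        using holomorphic_derivI[OF hol \<open>open exterior_disk\<close>] by blast
      have "((\<lambda>z. 1 / z) has_field_derivative - (1 / z\<^sup>2)) (at z)"
        using False by (auto intro!: derivative_eq_intros simp: power2_eq_square)
      from DERIV_chain2[OF dg this]
      have "((\<lambda>z. 1 / g (1 / z)) has_field_derivative f' z) (at z)"
        using gnz[OF \<open>1 / z \<in> exterior_disk\<close>] False
        by (auto intro!: derivative_eq_intros simp: f'_def U_def power2_eq_square)
      moreover have "open (ball 0 1 - {0::complex})" by auto
      ultimately show ?thesis
        by (rule has_field_derivative_transform_within_open) (use False z f_g in auto)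
    qed
    show "cmod (f' z - 1) \<le> k"
      using U[OF ext[of z]] z k by (auto simp: f'_def)
  next
    show "f 0 = 0" by (simp add: f_def)
  next
    fix z :: complex assume "0 < cmod z" "cmod z < 1"
    then show "f z = 1 / g (1 / z) \<and> g (1 / z) \<noteq> 0" using f_g gnz ext by blast
  qed
qed

theorem theorem4:
  fixes k :: real and g :: "complex \<Rightarrow> complex"
  assumes "0 < k" and "k < 1"
    and "g \<in> class_M"
    and "\<And>\<zeta>. \<zeta> \<in> exterior_disk \<Longrightarrow> cmod (U g \<zeta>) \<le> k"
  shows "inj_on g exterior_disk \<and>
    (\<exists>G. quasiconformal_extension k g G \<and> given_inside_by_formula g G)"
proof -
  obtain f f' where df: "\<And>z. cmod z < 1 \<Longrightarrow> (f has_field_derivative f' z) (at z)"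
    and f'k: "\<And>z. cmod z < 1 \<Longrightarrow> cmod (f' z - 1) \<le> k" and f0: "f 0 = 0"
    and fg: "\<And>z. 0 < cmod z \<Longrightarrow> cmod z < 1 \<Longrightarrow> f z = 1 / g (1 / z) \<and> g (1 / z) \<noteq> 0"
    using class_M_inverted[OF assms(3,4,1,2)] by metis
  \<comment> \<open>The disk is convex, so the bound on \<open>f' z - 1\<close> integrates to a
    Lipschitz constant.\<close>
  have "k-lipschitz_on (ball 0 1) (\<lambda>z. f z - z)"
  proof (rule lipschitz_onI)
    fix z w :: complex assume "z \<in> ball 0 1" "w \<in> ball 0 1"
    then show "dist (f z - z) (f w - w) \<le> k * dist z w"
      unfolding dist_norm
      by (intro field_differentiable_bound[where S = "ball 0 1" and f' = "\<lambda>z. f' z - 1"])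
        (auto intro!: derivative_eq_intros df[THEN has_field_derivative_at_within] f'k)
  qed (use assms in simp)
  \<comment> \<open>Nothing is known about \<open>f\<close> on the unit circle; the boundary values
    come from this extension, with the same constant.\<close>
  from lipschitz_extend_closure[OF this]
  obtain h where h: "k-lipschitz_on (cball 0 1) h" "\<And>z. cmod z < 1 \<Longrightarrow> h z = f z - z"
    by auto
  define F where "F z = z + h (fold_disk z)" for z
  have inside: "F z = f z" if "cmod z < 1" for z
    using h(2)[OF that] that by (simp add: F_def fold_disk_def)
  have outside: "F z = z + (f (1 / cnj z) - 1 / cnj z)" if "1 < cmod z" for z
    using h(2)[of "1 / cnj z"] that by (auto simp: F_def fold_disk_def norm_divide divide_less_eq)
  have hb: "cmod (h (fold_disk z) - h (fold_disk w)) \<le> k * cmod (z - w)" for z w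
  proof -
    have "cmod (h (fold_disk z) - h (fold_disk w)) \<le> k * cmod (fold_disk z - fold_disk w)"
      using lipschitz_onD[OF h(1)] norm_fold_disk_le by (simp add: dist_norm)
    also have "\<dots> \<le> k * cmod (z - w)"
      using assms norm_fold_disk_diff_le by (intro mult_left_mono) auto
    finally show ?thesis .
  qed
  \<comment> \<open>The bound for \<open>F z - z\<close> is again \<open>k\<close>: here
    \<open>h 0 = 0\<close>, and the folded point has modulus at most \<open>1\<close>.\<close>
  interpret near_identity k k F
  proof
    show "F 0 = 0" using inside f0 by simp
    show "cmod (F z - F w - (z - w)) \<le> k * cmod (z - w)" for z w
      using hb[of z w] by (simp add: F_def algebra_simps)
    show "cmod (F z - z) \<le> k" for z
    proof -
      have "cmod (h (fold_disk z) - h 0) \<le> k * cmod (fold_disk z)"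
        using lipschitz_onD[OF h(1), of "fold_disk z" 0] norm_fold_disk_le by (simp add: dist_norm)
      also have "\<dots> \<le> k * 1" using norm_fold_disk_le assms by (intro mult_left_mono) auto
      finally show ?thesis using h(2)[of 0] f0 by (simp add: F_def)
    qed
    fix z :: complex assume "cmod z \<noteq> 1"
    then consider "cmod z < 1" | "1 < cmod z" by linarith
    then show "beltrami_at k F z"
    proof cases
      case 1
      have "beltrami_at k f z"
        unfolding beltrami_at_def
        by (intro exI[of _ "f' z"] exI[of _ 0])
          (use df[OF 1] assms in \<open>auto simp: has_field_derivative_def\<close>)
      then show ?thesis
        by (rule beltrami_at_transform[where S = "ball 0 1"]) (use 1 inside in auto)
    next
      case 2
      define u where "u = 1 / cnj z"
      have u: "cmod u < 1" using 2 by (auto simp: u_def norm_divide divide_less_eq)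
      have "cnj z \<noteq> 0" using 2 by auto
      \<comment> \<open>Outside the disk the deviation from the identity is a holomorphic function
        of \<open>cnj w\<close>. It contributes only to the coefficient \<open>b\<close>, leaving
        \<open>a = 1\<close>, and the factor \<open>1 / (cmod z)^2 < 1\<close> preserves the bound
        \<open>k\<close>.\<close>
      let ?h = "\<lambda>w. f (1 / w) - 1 / w"
      have "(?h has_field_derivative (f' u - 1) * - (1 / (cnj z)\<^sup>2)) (at (cnj z))"
      proof -
        have i: "((\<lambda>z. 1 / z) has_field_derivative - (1 / (cnj z)\<^sup>2)) (at (cnj z))"
          using \<open>cnj z \<noteq> 0\<close> by (rule has_field_derivative_one_divide)
        have "((\<lambda>w. f w - w) has_field_derivative f' u - 1) (at (1 / cnj z))"
          using df[OF u] unfolding u_def by (auto intro!: derivative_eq_intros)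
        from DERIV_chain2[OF this i] show ?thesis .
      qed
      then have "((\<lambda>w. ?h (cnj w)) has_derivative (\<lambda>v. (f' u - 1) * - (1 / (cnj z)\<^sup>2) * cnj v)) (at z)"
        unfolding has_field_derivative_def
        by (rule has_derivative_compose[rotated])
          (rule bounded_linear_imp_has_derivative[OF bounded_linear_cnj])
      then have "((\<lambda>w. w + ?h (cnj w)) has_derivative
          (\<lambda>v. 1 * v + (f' u - 1) * - (1 / (cnj z)\<^sup>2) * cnj v)) (at z)"
        unfolding mult_1 by (rule has_derivative_add[OF has_derivative_ident])
      moreover have "cmod ((f' u - 1) * - (1 / (cnj z)\<^sup>2)) \<le> k * cmod 1"
      proof -
        have "cmod ((f' u - 1) * - (1 / (cnj z)\<^sup>2)) = cmod (f' u - 1) * (1 / (cmod z)\<^sup>2)"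
          by (simp add: norm_mult norm_divide norm_power)
        also have "\<dots> \<le> k * 1"
          using one_le_power[of "cmod z" 2] 2 assms
          by (intro mult_mono f'k u) (auto simp: divide_le_eq_1)
        finally show ?thesis by simp
      qed
      ultimately have "beltrami_at k (\<lambda>w. w + ?h (cnj w)) z"
        unfolding beltrami_at_def by blast
      moreover have "open {z::complex. 1 < cmod z}"
        by (intro open_Collect_less continuous_intros)
      ultimately show ?thesis
        by (rule beltrami_at_transform) (use 2 outside in auto)
    qed
  qed (use assms in auto)
  have G_ext: "G (Some \<zeta>) = Some (g \<zeta>)" if "\<zeta> \<in> exterior_disk" for \<zeta>
  proof -
    have "\<zeta> \<noteq> 0" "cmod (1 / \<zeta>) < 1" using that by (auto simp: exterior_disk_def norm_divide divide_less_eq)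
    then show ?thesis using inside[of "1 / \<zeta>"] fg[of "1 / \<zeta>"] by (simp add: G_def)
  qed
  have "inj_on g exterior_disk"
  proof (rule inj_onI)
    fix z w assume "z \<in> exterior_disk" "w \<in> exterior_disk" "g z = g w"
    then have "G (Some z) = G (Some w)" by (simp add: G_ext)
    moreover have "inj G"
      using homeomorphic_imp_injective_map[OF homeomorphic_map_G] by simp
    ultimately show "z = w" by (simp add: inj_eq)
  qed
  moreover have "quasiconformal_extension k g G"
    unfolding quasiconformal_extension_def using quasiconformal_G G_ext by (simp add: G_def F0)
  moreover have "given_inside_by_formula g G"
    unfolding given_inside_by_formula_def
  proof (intro allI impI)
    fix \<zeta> :: complex assume \<zeta>: "0 < cmod \<zeta> \<and> cmod \<zeta> < 1"
    then have "\<zeta> \<noteq> 0" "1 < cmod (1 / \<zeta>)" by (auto simp: norm_divide)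
    define c where "c = g (1 / cnj \<zeta>)"
    have c: "f (cnj \<zeta>) = 1 / c" "c \<noteq> 0" using fg[of "cnj \<zeta>"] \<zeta> by (auto simp: c_def)
    \<comment> \<open>The origin of the stated formula: \<open>F (1 / \<zeta>)\<close> is
      \<open>1 / \<zeta> + 1 / c - cnj \<zeta>\<close>, brought to the denominator
      \<open>c\<close>.\<close>
    have "F (1 / \<zeta>) = (1 + (1 / \<zeta> - cnj \<zeta>) * c) / c"
      using outside[OF \<open>1 < cmod (1 / \<zeta>)\<close>] c by (simp add: field_simps)
    moreover have "G (Some \<zeta>) = Some (1 / F (1 / \<zeta>))" using \<open>\<zeta> \<noteq> 0\<close> by (simp add: G_def)
    \<comment> \<open>Hence the denominator in the formula does not vanish, and the quotient is
      finite.\<close>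
    moreover have "F (1 / \<zeta>) \<noteq> 0" using \<open>\<zeta> \<noteq> 0\<close> by simp
    ultimately show "G (Some \<zeta>) = sphere_quotient (g (1 / cnj \<zeta>))
                       (1 + (1 / \<zeta> - cnj \<zeta>) * g (1 / cnj \<zeta>))"
      by (auto simp: sphere_quotient_def c_def[symmetric])
  qed
  ultimately show ?thesis by blast
qed

end
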